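(* Let $\boldsymbol p\in\mathbb N_0^2\setminus\{(0,0)\}$. If $W:\mathcal B(\mathcal H_{\boldsymbol p})\to C^\infty_{\mathbb C}(\mathcal E)$ is a symbol correspondence with characteristic matrices $\mathbf C(\boldsymbol a)$, then the induced twisted product $\star$ is given by $$Z\mathbf C(\boldsymbol a_1)^{\sigma_1}_{\boldsymbol\nu_1,J_1}\star Z\mathbf C(\boldsymbol a_2)^{\sigma_2}_{\boldsymbol\nu_2,J_2}=\sqrt{\dim(\boldsymbol p)}\sum_{\substack{(\boldsymbol a;\sigma)\\ \boldsymbol\nu,J}}(-1)^{|\boldsymbol p|+2(t_{\boldsymbol\nu}+u_{\boldsymbol\nu})}\begin{bmatrix}(\boldsymbol a_1;\sigma_1)&(\boldsymbol a_2;\sigma_2)&(\boldsymbol a;\sigma)\\ \boldsymbol\nu_1,J_1&\boldsymbol\nu_2,J_2&\check{\boldsymbol\nu},J\end{bmatrix}[\boldsymbol p]\;Z\mathbf C(\boldsymbol a)^\sigma_{\boldsymbol\nu,J},$$ where $(\boldsymbol a;\sigma)$ runs over the Clebsch-Gordan series of $\boldsymbol p\otimes\check{\boldsymbol p}$ and summations over $\boldsymbol\nu$ and $J$ are effectively restricted by $t_{\boldsymbol\nu}=t_{\boldsymbol\nu_1}+t_{\boldsymbol\nu_2}$, $u_{\boldsymbol\nu}=u_{\boldsymbol\nu_1}+u_{\boldsymbol\nu_2}$ and $\delta(J_1,J_2,J)=1$.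
   Context: Representations. In a representation of $SU(3)$ (extended to $\mathfrak{sl}(3,\mathbb C)$) let $T_+,T_-,T_3,U_+,U_-,U_3$ be the images of $E_{12},E_{21},\tfrac12(E_{11}-E_{22}),E_{23},E_{32},\tfrac12(E_{22}-E_{33})$. For $\boldsymbol p=(p,q)\in\mathbb N_0^2$, "the irrep $\boldsymbol p$" is the unitary irrep on $\mathcal H_{\boldsymbol p}$ whose highest weight vector has eigenvalue $p/2$ for $T_3$ and $q/2$ for $U_3$; $\dim(\boldsymbol p)=\frac{(p+1)(q+1)(p+q+2)}2$, $|\boldsymbol p|=p+q$, $\check{\boldsymbol p}=(q,p)$ (the dual irrep). Inner products are linear in the second entry. Gelfand-Tsetlin (GT) basis: an orthonormal basis $\{\boldsymbol e(\boldsymbol p;\boldsymbol\nu,J)\}$ indexed by $\boldsymbol\nu=(\nu_1,\nu_2,\nu_3)$ and $J$ where, for integers $0\le r_-\le q\le r_+\le p+q$ and $r_-\le\nu_3\le r_+$: $\nu_1=p+2q-(r_++r_-)$, $\nu_2=r_++r_--\nu_3$, $J=\frac12(r_+-r_-)$. Put $t_{\boldsymbol\nu}=\frac{\nu_1-\nu_2}2$, $u_{\boldsymbol\nu}=\frac{\nu_2-\nu_3}2$ (the eigenvalues of $T_3,U_3$). The basis is determined by a unit highest weight vector $\boldsymbol e(\boldsymbol p;(p+q,q,0),q/2)$ via, with $u=u_{\boldsymbol\nu}$, $U_-\boldsymbol e(\boldsymbol p;\boldsymbol\nu,J)=\sqrt{(J+u)(J-u+1)}\,\boldsymbol e(\boldsymbol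 p;(\nu_1,\nu_2-1,\nu_3+1),J)$ and $T_-\boldsymbol e(\boldsymbol p;\boldsymbol\nu,J)=\sqrt{\tfrac{(J-u)(p+q+J-u-\nu_3+1)(q+J-u-\nu_3)(u-J+\nu_3+1)}{2J(2J+1)}}\,\boldsymbol e(\boldsymbol p;(\nu_1-1,\nu_2+1,\nu_3),J-\tfrac12)+\sqrt{\tfrac{(J+u+1)(p+q-J-u-\nu_3)(J+u+1+\nu_3-q)(J+u+2+\nu_3)}{2(J+1)(2J+1)}}\,\boldsymbol e(\boldsymbol p;(\nu_1-1,\nu_2+1,\nu_3),J+\tfrac12)$ (terms with zero numerator are $0$). For a GT label $\boldsymbol\nu$ of an irrep $\boldsymbol a$ put $\check{\boldsymbol\nu}=(|\boldsymbol a|,|\boldsymbol a|,|\boldsymbol a|)-\boldsymbol\nu$, a GT label of $\check{\boldsymbol a}$. The induced GT basis of $\mathcal H_{\check{\boldsymbol p}}=\mathcal H_{\boldsymbol p}^*$ is $\check{\boldsymbol e}(\check{\boldsymbol p};\check{\boldsymbol\nu},J)=(-1)^{2(t_{\boldsymbol\nu}+u_{\boldsymbol\nu})}\boldsymbol e^*(\boldsymbol p;\boldsymbol\nu,J)$. Wigner functions: $D^{\boldsymbol a}_{\boldsymbol\nu J,\boldsymbol\mu L}(g)=\langle\boldsymbol e(\boldsymbol a;\boldsymbol\nu,J)|\rho(g)\boldsymbol e(\boldsymbol a;\boldsymbol\mu,L)\rangle$. Coupled basis. $\mathcal B(\mathcal H_{\boldsymbol p})\simeq\mathcal H_{\boldsymbol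 p}\otimes\mathcal H_{\boldsymbol p}^*$ (the representation $\boldsymbol p\otimes\check{\boldsymbol p}$), with action $A^g=\rho(g)A\rho(g)^{-1}$ and inner product $\operatorname{tr}(A^\dagger B)$, is decomposed orthogonally into irreps $(\boldsymbol a;\sigma)$ of class $\boldsymbol a$, $1\le\sigma\le\mathfrak m(\boldsymbol p;\boldsymbol a)$ (the multiplicity); this is the Clebsch-Gordan series. A coupled basis is the union of GT bases $\boldsymbol e((\boldsymbol a;\sigma);\boldsymbol\nu,J)$ of the $(\boldsymbol a;\sigma)$. Clebsch-Gordan coefficients: $C^{\boldsymbol p,\check{\boldsymbol p},(\boldsymbol a;\sigma)}_{\boldsymbol\nu_1J_1,\boldsymbol\nu_2J_2,\boldsymbol\nu J}=\langle\boldsymbol e((\boldsymbol a;\sigma);\boldsymbol\nu,J)|\boldsymbol e(\boldsymbol p;\boldsymbol\nu_1,J_1)\otimes\check{\boldsymbol e}(\check{\boldsymbol p};\boldsymbol\nu_2,J_2)\rangle$. Decomposition and phases are chosen so that these are all real, $\boldsymbol e((\boldsymbol a;\sigma);\boldsymbol\nu,J)^\dagger=(-1)^{2(t_{\boldsymbol\nu}+u_{\boldsymbol\nu})}\boldsymbol e((\check{\boldsymbol a};\sigma);\check{\boldsymbol\nu},J)$, and $\boldsymbol e((0,0);(0,0,0),0)=\mathds 1/\sqrt{\dim\boldsymbol p}$ (possible by known results). Wigner product symbol: for $(\boldsymbol a_1;\sigma_1),(\boldsymbol a_2;\sigma_2),(\boldsymbol a;\sigma)$ in the Clebsch-Gordan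 series of $\boldsymbol p\otimes\check{\boldsymbol p}$, GT labels $(\boldsymbol\nu_i,J_i)$ of $\boldsymbol a_i$ and $(\boldsymbol\nu,J)$ of $\check{\boldsymbol a}$, $$\begin{bmatrix}(\boldsymbol a_1;\sigma_1)&(\boldsymbol a_2;\sigma_2)&(\boldsymbol a;\sigma)\\ \boldsymbol\nu_1,J_1&\boldsymbol\nu_2,J_2&\boldsymbol\nu,J\end{bmatrix}[\boldsymbol p]=\sum_{\substack{\boldsymbol\mu_1,\boldsymbol\mu_2,\boldsymbol\mu_3\\ I_1,I_2,I_3}}(-1)^{|\boldsymbol p|+2(t_{\boldsymbol\nu}+t_{\boldsymbol\mu_2}+u_{\boldsymbol\nu}+u_{\boldsymbol\mu_2})}C^{\boldsymbol p,\check{\boldsymbol p},(\boldsymbol a_1;\sigma_1)}_{\boldsymbol\mu_1I_1,\boldsymbol\mu_2I_2,\boldsymbol\nu_1J_1}C^{\boldsymbol p,\check{\boldsymbol p},(\boldsymbol a_2;\sigma_2)}_{\check{\boldsymbol\mu}_2I_2,\boldsymbol\mu_3I_3,\boldsymbol\nu_2J_2}C^{\boldsymbol p,\check{\boldsymbol p},(\boldsymbol a;\sigma)}_{\boldsymbol\mu_1I_1,\boldsymbol\mu_3I_3,\check{\boldsymbol\nu}J},$$ the sum being over GT labels $(\boldsymbol\mu_1,I_1)$ of $\boldsymbol p$ and $(\boldsymbol\mu_2,I_2),(\boldsymbol\mu_3,I_3)$ of $\check{\boldsymbol p}$. $\delta(x,y,z)=1$ if $x,y,z$ satisfy the triangle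 inequality and $x+y+z\in\mathbb Z$, and $0$ otherwise. Symbol correspondences. $\mathcal E\simeq SU(3)/T$ is the full flag manifold, $T$ the diagonal maximal torus, $\mathrm z_0\in\mathcal E$ a point with isotropy group $T$, with the invariant integral of total mass $1$. For $\boldsymbol a=(a,b)$ with $a\equiv b\pmod 3$ (true for all $\boldsymbol a$ in $\boldsymbol p\otimes\check{\boldsymbol p}$): $m(\boldsymbol a)=\min\{a,b\}+1$, $\boldsymbol 0_{\boldsymbol a}=(c,c,c)$ with $c=(a+2b)/3$, $J^\gamma_{\boldsymbol a}=\gamma-1+|a-b|/3$ for $1\le\gamma\le m(\boldsymbol a)$; harmonics $Z^{(\boldsymbol a,\gamma)}_{\boldsymbol\nu,J}(g\mathrm z_0)=\sqrt{\dim\boldsymbol a}\;\overline{D^{\boldsymbol a}_{\boldsymbol\nu J,\boldsymbol 0_{\boldsymbol a}J^\gamma_{\boldsymbol a}}(g)}$. A symbol correspondence $W:\mathcal B(\mathcal H_{\boldsymbol p})\to C^\infty_{\mathbb C}(\mathcal E)$ is an injective linear map with: (1) $W_{A^g}=(W_A)^g$, where $f^g(\mathrm z)=f(g^{-1}\mathrm z)$; (2) $W_{A^\dagger}=\overline{W_A}$; (3) $\int W_A\,d\mathrm z=\operatorname{tr}(A)/\dim(\boldsymbol p)$. Its characteristic matrices $\mathbf C(\boldsymbol a)=(c^\sigma_\gamma(\boldsymbol a))$, of order $m(\boldsymbol a)\times\mathfrak m(\boldsymbol p;\boldsymbol a)$, are defined by $W:\sqrt{\dim\boldsymbol p}\,\boldsymbol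 e((\boldsymbol a;\sigma);\boldsymbol\nu,J)\mapsto\sum_{\gamma=1}^{m(\boldsymbol a)}c^\sigma_\gamma(\boldsymbol a)Z^{(\boldsymbol a,\gamma)}_{\boldsymbol\nu,J}=:Z\mathbf C(\boldsymbol a)^\sigma_{\boldsymbol\nu,J}$. The twisted product induced by $W$ is the product on the image of $W$ given by $W_{A_1}\star W_{A_2}=W_{A_1A_2}$. *)

theory Defs
  imports "HOL-Analysis.Analysis"
begin

section \<open>Complex inner product spaces\<close>

text \<open>The inner product is linear in the second entry.  The real inner product (hence the norm and
  the topology) is its real part.  The instances below give the standard inner product on
  \<open>complex^'n\<close> and, iterating, \<open>trace (dagger A ** B)\<close> on \<open>complex^'n^'n\<close>.\<close>

class complex_inner_space = real_inner +
  fixes cscale :: "complex \<Rightarrow> 'a \<Rightarrow> 'a" (infixr "*\<^sub>C" 75)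
    and cinner :: "'a \<Rightarrow> 'a \<Rightarrow> complex"
  assumes cscale_add_right: "c *\<^sub>C (x + y) = c *\<^sub>C x + c *\<^sub>C y"
    and cscale_add_left: "(c + d) *\<^sub>C x = c *\<^sub>C x + d *\<^sub>C x"
    and cscale_cscale: "c *\<^sub>C d *\<^sub>C x = (c * d) *\<^sub>C x"
    and scaleR_conv_cscale: "r *\<^sub>R x = complex_of_real r *\<^sub>C x"
    and cinner_commute: "cinner x y = cnj (cinner y x)"
    and cinner_add_right: "cinner x (y + z) = cinner x y + cinner x z"
    and cinner_cscale_right: "cinner x (c *\<^sub>C y) = c * cinner x y"
    and Re_cinner: "Re (cinner x y) = inner x y"

instantiation complex :: complex_inner_space
begin
definition "c *\<^sub>C (x::complex) = c * x"
definition "cinner (x::complex) y = cnj x * y"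
instance
  by standard (auto simp: cscale_complex_def cinner_complex_def algebra_simps scaleR_conv_of_real
      inner_complex_def)
end

instantiation vec :: (complex_inner_space, finite) complex_inner_space
begin
definition "c *\<^sub>C (x::'a^'b) = (\<chi> i. c *\<^sub>C x $ i)"
definition "cinner (x::'a^'b) y = (\<Sum>i\<in>UNIV. cinner (x $ i) (y $ i))"
instance
proof
  show "r *\<^sub>R x = complex_of_real r *\<^sub>C x" for r and x :: "'a^'b"
    by (simp add: vec_eq_iff cscale_vec_def scaleR_conv_cscale)
  show "cinner x y = cnj (cinner y x)" for x y :: "'a^'b"
    unfolding cinner_vec_def cnj_sum by (rule sum.cong[OF refl]) (rule cinner_commute)
qed (simp_all add: vec_eq_iff cscale_vec_def cinner_vec_def cscale_add_right cscale_add_left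
      cscale_cscale cinner_add_right cinner_cscale_right sum.distrib sum_distrib_left
      Re_cinner inner_vec_def)
end

global_interpretation complex_vector: vector_space "cscale :: complex \<Rightarrow> 'a \<Rightarrow> 'a::complex_inner_space"
  defines csubspace = complex_vector.subspace
    and cspan = complex_vector.span
proof
  show "1 *\<^sub>C x = x" for x :: 'a
    by (metis of_real_1 scaleR_conv_cscale scaleR_one)
qed (simp_all add: cscale_add_right cscale_add_left cscale_cscale)

section \<open>\<open>SU(3)\<close> and its representations\<close>

definition dagger :: "complex^'m^'n \<Rightarrow> complex^'n^'m" where
  "dagger A = (\<chi> i j. cnj (A $ j $ i))"

definition SU3 :: "(complex^3^3) set" where
  "SU3 = {g. dagger g ** g = mat 1 \<and> det g = 1}"

definition mat_exp :: "complex^'n^'n \<Rightarrow> complex^'n^'n" where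
  "mat_exp X = (\<Sum>k. (1 / fact k) *\<^sub>R (((**) X ^^ k) (mat 1)))"

type_synonym 'v action = "complex^3^3 \<Rightarrow> 'v \<Rightarrow> 'v"

text \<open>Representations live on a complex subspace \<open>V\<close> of an ambient space; \<open>\<pi> g v\<close> is only relevant
  for \<open>g \<in> SU3\<close> and \<open>v \<in> V\<close>.\<close>

definition unitary_rep :: "'v::complex_inner_space set \<Rightarrow> 'v action \<Rightarrow> bool" where
  "unitary_rep V \<pi> \<longleftrightarrow> csubspace V \<and>
     (\<forall>g\<in>SU3. \<forall>v\<in>V. \<pi> g v \<in> V) \<and>
     (\<forall>g\<in>SU3. \<forall>v\<in>V. \<forall>w\<in>V. \<forall>c. \<pi> g (v + w) = \<pi> g v + \<pi> g w \<and> \<pi> g (c *\<^sub>C v) = c *\<^sub>C \<pi> g v) \<and>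
     (\<forall>g\<in>SU3. \<forall>v\<in>V. \<forall>w\<in>V. cinner (\<pi> g v) (\<pi> g w) = cinner v w) \<and>
     (\<forall>v\<in>V. \<pi> (mat 1) v = v) \<and>
     (\<forall>g\<in>SU3. \<forall>h\<in>SU3. \<forall>v\<in>V. \<pi> (g ** h) v = \<pi> g (\<pi> h v)) \<and>
     (\<forall>v\<in>V. continuous_on SU3 (\<lambda>g. \<pi> g v))"

definition irreducible_rep :: "'v::complex_inner_space set \<Rightarrow> 'v action \<Rightarrow> bool" where
  "irreducible_rep V \<pi> \<longleftrightarrow> V \<noteq> {0} \<and>
     (\<forall>S. csubspace S \<and> S \<subseteq> V \<and> (\<forall>g\<in>SU3. \<forall>v\<in>S. \<pi> g v \<in> S) \<longrightarrow> S = {0} \<or> S = V)"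

definition lie_act :: "'v::complex_inner_space action \<Rightarrow> 'v action" where
  "lie_act \<pi> X v = vector_derivative (\<lambda>t::real. \<pi> (mat_exp (t *\<^sub>R X)) v) (at 0)"

text \<open>Complex-linear extension from \<open>su(3)\<close> to \<open>sl(3)\<close>: write \<open>Z = X + \<i>Y\<close> with \<open>X\<close>, \<open>Y\<close>
  skew-Hermitian.\<close>

definition sl_act :: "'v::complex_inner_space action \<Rightarrow> 'v action" where
  "sl_act \<pi> Z v = lie_act \<pi> ((1/2) *\<^sub>C (Z - dagger Z)) v
                 + \<i> *\<^sub>C lie_act \<pi> ((1 / (2 * \<i>)) *\<^sub>C (Z + dagger Z)) v"

definition mat_unit :: "3 \<Rightarrow> 3 \<Rightarrow> complex^3^3" where
  "mat_unit i j = (\<chi> k l. if k = i \<and> l = j then 1 else 0)"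

definition "T_plus \<pi> = sl_act \<pi> (mat_unit 1 2)"
definition "T_minus \<pi> = sl_act \<pi> (mat_unit 2 1)"
definition "T_three \<pi> = sl_act \<pi> ((1/2) *\<^sub>C (mat_unit 1 1 - mat_unit 2 2))"
definition "U_plus \<pi> = sl_act \<pi> (mat_unit 2 3)"
definition "U_minus \<pi> = sl_act \<pi> (mat_unit 3 2)"
definition "U_three \<pi> = sl_act \<pi> ((1/2) *\<^sub>C (mat_unit 2 2 - mat_unit 3 3))"

type_synonym irrep = "nat \<times> nat"

fun highest_weight_vector :: "irrep \<Rightarrow> 'v::complex_inner_space action \<Rightarrow> 'v \<Rightarrow> bool" where
  "highest_weight_vector (p, q) \<pi> v \<longleftrightarrow> v \<noteq> 0 \<and> T_plus \<pi> v = 0 \<and> U_plus \<pi> v = 0 \<and>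
     T_three \<pi> v = (of_nat p / 2) *\<^sub>C v \<and> U_three \<pi> v = (of_nat q / 2) *\<^sub>C v"

definition is_irrep :: "irrep \<Rightarrow> 'v::complex_inner_space set \<Rightarrow> 'v action \<Rightarrow> bool" where
  "is_irrep a V \<pi> \<longleftrightarrow> unitary_rep V \<pi> \<and> irreducible_rep V \<pi> \<and> (\<exists>v\<in>V. highest_weight_vector a \<pi> v)"

fun irrep_dim :: "irrep \<Rightarrow> real" where
  "irrep_dim (p, q) = real ((p + 1) * (q + 1) * (p + q + 2)) / 2"

fun irrep_size :: "irrep \<Rightarrow> nat" where
  "irrep_size (p, q) = p + q"

fun irrep_dual :: "irrep \<Rightarrow> irrep" where
  "irrep_dual (p, q) = (q, p)"

section \<open>Gelfand-Tsetlin bases\<close>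

type_synonym gt_weight = "int \<times> int \<times> int"
type_synonym gt_label = "gt_weight \<times> real"

fun GT_labels :: "irrep \<Rightarrow> gt_label set" where
  "GT_labels (p, q) =
     {((int p + 2 * int q - (rp + rm), rp + rm - n3, n3), real_of_int (rp - rm) / 2) | rm rp n3.
        0 \<le> rm \<and> rm \<le> int q \<and> int q \<le> rp \<and> rp \<le> int p + int q \<and> rm \<le> n3 \<and> n3 \<le> rp}"

fun gt_t :: "gt_weight \<Rightarrow> real" where
  "gt_t (n1, n2, n3) = real_of_int (n1 - n2) / 2"

fun gt_u :: "gt_weight \<Rightarrow> real" where
  "gt_u (n1, n2, n3) = real_of_int (n2 - n3) / 2"

text \<open>\<open>(-1)\<^sup>x\<close>; only applied to \<open>x\<close> that are integers (such as \<open>2 * (t + u)\<close>).\<close>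

definition gt_sign :: "real \<Rightarrow> complex" where
  "gt_sign x = (-1) powi \<lfloor>x\<rfloor>"

fun gt_check :: "irrep \<Rightarrow> gt_weight \<Rightarrow> gt_weight" where
  "gt_check a (n1, n2, n3) =
     (int (irrep_size a) - n1, int (irrep_size a) - n2, int (irrep_size a) - n3)"

text \<open>In the lowering formulas, a target label that is not a GT label has coefficient \<open>0\<close>.  The case
  \<open>J = 0\<close> of the first denominator is harmless: the numerator vanishes and \<open>0 / 0 = 0\<close>.\<close>

fun is_GT_basis ::
  "irrep \<Rightarrow> 'v::complex_inner_space set \<Rightarrow> 'v action \<Rightarrow> (gt_label \<Rightarrow> 'v) \<Rightarrow> bool" where
  "is_GT_basis (p, q) V \<pi> e \<longleftrightarrow>
     (\<forall>l\<in>GT_labels (p, q). \<forall>l'\<in>GT_labels (p, q). cinner (e l) (e l') = (if l = l' then 1 else 0)) \<and>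
     cspan (e ` GT_labels (p, q)) = V \<and>
     highest_weight_vector (p, q) \<pi> (e ((int p + int q, int q, 0), real q / 2)) \<and>
     (\<forall>n1 n2 n3 J. ((n1, n2, n3), J) \<in> GT_labels (p, q) \<longrightarrow>
        (let P = real p; Q = real q; N = real_of_int n3;
             t = gt_t (n1, n2, n3); u = gt_u (n1, n2, n3); v = e ((n1, n2, n3), J)
         in T_three \<pi> v = complex_of_real t *\<^sub>C v \<and>
            U_three \<pi> v = complex_of_real u *\<^sub>C v \<and>
            U_minus \<pi> v = sqrt ((J + u) * (J - u + 1)) *\<^sub>R e ((n1, n2 - 1, n3 + 1), J) \<and>
            T_minus \<pi> v =
              sqrt ((J - u) * (P + Q + J - u - N + 1) * (Q + J - u - N) * (u - J + N + 1)
                      / (2 * J * (2 * J + 1)))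
                *\<^sub>R e ((n1 - 1, n2 + 1, n3), J - 1/2) +
              sqrt ((J + u + 1) * (P + Q - J - u - N) * (J + u + 1 + N - Q) * (J + u + 2 + N)
                      / (2 * (J + 1) * (2 * J + 1)))
                *\<^sub>R e ((n1 - 1, n2 + 1, n3), J + 1/2)))"

definition wigner_D ::
  "'v::complex_inner_space action \<Rightarrow> (gt_label \<Rightarrow> 'v) \<Rightarrow> gt_label \<Rightarrow> gt_label \<Rightarrow> complex^3^3 \<Rightarrow> complex"
  where "wigner_D \<pi> e l l' g = cinner (e l) (\<pi> g (e l'))"

section \<open>Coupled bases of operators\<close>

definition conj_act :: "(complex^3^3 \<Rightarrow> complex^'n^'n) \<Rightarrow> (complex^'n^'n) action" where
  "conj_act \<rho> g A = \<rho> g ** A ** matrix_inv (\<rho> g)"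

text \<open>The GT basis of the dual space induced by the GT basis \<open>e\<close> of \<open>p\<close>; the argument is a label of
  \<open>irrep_dual p\<close>, and \<open>gt_check p n\<close> is the label of \<open>p\<close> it comes from.\<close>

fun gt_dual_basis ::
  "irrep \<Rightarrow> (gt_label \<Rightarrow> complex^'n) \<Rightarrow> gt_label \<Rightarrow> (complex^'n \<Rightarrow> complex)" where
  "gt_dual_basis p e (n, J) =
     (\<lambda>v. gt_sign (2 * (gt_t (gt_check p n) + gt_u (gt_check p n))) * cinner (e (gt_check p n, J)) v)"

text \<open>The identification of \<open>H \<otimes> H\<^sup>*\<close> with the operators on \<open>H\<close>.\<close>

definition tensor_op :: "complex^'n \<Rightarrow> (complex^'n \<Rightarrow> complex) \<Rightarrow> complex^'n^'n" where
  "tensor_op v f = matrix (\<lambda>w. f w *\<^sub>C v)"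

definition CG_coeff ::
  "irrep \<Rightarrow> (gt_label \<Rightarrow> complex^'n) \<Rightarrow> (irrep \<times> nat \<Rightarrow> gt_label \<Rightarrow> complex^'n^'n) \<Rightarrow>
   irrep \<times> nat \<Rightarrow> gt_label \<Rightarrow> gt_label \<Rightarrow> gt_label \<Rightarrow> complex" where
  "CG_coeff p e E x l1 l2 l = cinner (E x l) (tensor_op (e l1) (gt_dual_basis p e l2))"

text \<open>The Clebsch-Gordan series, for the multiplicity function \<open>m\<close>.\<close>

definition CG_series :: "(irrep \<Rightarrow> nat) \<Rightarrow> (irrep \<times> nat) set" where
  "CG_series m = {(a, \<sigma>). 1 \<le> \<sigma> \<and> \<sigma> \<le> m a}"

text \<open>\<open>E (a, \<sigma>)\<close> is the GT basis of the summand \<open>(a; \<sigma>)\<close>.  As the summands decompose the whole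
  operator space, \<open>m a\<close> is forced to be the multiplicity of \<open>a\<close>.\<close>

definition is_coupled_basis ::
  "irrep \<Rightarrow> (complex^3^3 \<Rightarrow> complex^'n^'n) \<Rightarrow> (gt_label \<Rightarrow> complex^'n) \<Rightarrow> (irrep \<Rightarrow> nat) \<Rightarrow>
   (irrep \<times> nat \<Rightarrow> gt_label \<Rightarrow> complex^'n^'n) \<Rightarrow> bool" where
  "is_coupled_basis p \<rho> e m E \<longleftrightarrow>
     (\<forall>(a, \<sigma>)\<in>CG_series m.
        is_irrep a (cspan (E (a, \<sigma>) ` GT_labels a)) (conj_act \<rho>) \<and>
        is_GT_basis a (cspan (E (a, \<sigma>) ` GT_labels a)) (conj_act \<rho>) (E (a, \<sigma>))) \<and>
     (\<forall>(a, \<sigma>)\<in>CG_series m. \<forall>(a', \<sigma>')\<in>CG_series m. (a, \<sigma>) \<noteq> (a', \<sigma>') \<longrightarrow>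
        (\<forall>l\<in>GT_labels a. \<forall>l'\<in>GT_labels a'. cinner (E (a, \<sigma>) l) (E (a', \<sigma>') l') = 0)) \<and>
     cspan (\<Union>(a, \<sigma>)\<in>CG_series m. E (a, \<sigma>) ` GT_labels a) = UNIV \<and>
     (\<forall>(a, \<sigma>)\<in>CG_series m. \<forall>l\<in>GT_labels a. \<forall>l1\<in>GT_labels p. \<forall>l2\<in>GT_labels (irrep_dual p).
        CG_coeff p e E (a, \<sigma>) l1 l2 l \<in> \<real>) \<and>
     (\<forall>(a, \<sigma>)\<in>CG_series m. \<forall>(n, J)\<in>GT_labels a.
        dagger (E (a, \<sigma>) (n, J)) =
          gt_sign (2 * (gt_t n + gt_u n)) *\<^sub>C E (irrep_dual a, \<sigma>) (gt_check a n, J)) \<and>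
     E ((0, 0), 1) ((0, 0, 0), 0) = (1 / sqrt (irrep_dim p)) *\<^sub>R mat 1"

text \<open>Wigner product symbol; the last label \<open>(n, J)\<close> is a label of \<open>irrep_dual a\<close>.\<close>

fun wigner_symbol ::
  "irrep \<Rightarrow> (gt_label \<Rightarrow> complex^'n) \<Rightarrow> (irrep \<times> nat \<Rightarrow> gt_label \<Rightarrow> complex^'n^'n) \<Rightarrow>
   irrep \<times> nat \<Rightarrow> gt_label \<Rightarrow> irrep \<times> nat \<Rightarrow> gt_label \<Rightarrow> irrep \<times> nat \<Rightarrow> gt_label \<Rightarrow> complex" where
  "wigner_symbol p e E x1 l1 x2 l2 (a, \<sigma>) (n, J) =
     (\<Sum>(k1, I1)\<in>GT_labels p. \<Sum>(k2, I2)\<in>GT_labels (irrep_dual p). \<Sum>(k3, I3)\<in>GT_labels (irrep_dual p).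
        gt_sign (real (irrep_size p) + 2 * (gt_t n + gt_t k2 + gt_u n + gt_u k2)) *
        CG_coeff p e E x1 (k1, I1) (k2, I2) l1 *
        CG_coeff p e E x2 (gt_check (irrep_dual p) k2, I2) (k3, I3) l2 *
        CG_coeff p e E (a, \<sigma>) (k1, I1) (k3, I3) (gt_check (irrep_dual a) n, J))"

definition triangle_delta :: "real \<Rightarrow> real \<Rightarrow> real \<Rightarrow> nat" where
  "triangle_delta x y z = (if \<bar>x - y\<bar> \<le> z \<and> z \<le> x + y \<and> x + y + z \<in> \<int> then 1 else 0)"

section \<open>The flag manifold\<close>

definition max_torus :: "(complex^3^3) set" where
  "max_torus = {g \<in> SU3. \<forall>i j. i \<noteq> j \<longrightarrow> g $ i $ j = 0}"

typedef flag = "{(\<lambda>t. g ** t) ` max_torus | g. g \<in> SU3}"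
  morphisms coset_of_flag flag_of_coset
proof -
  have "dagger (mat 1 :: complex^3^3) = mat 1"
    by (auto simp: dagger_def mat_def vec_eq_iff)
  then have "mat 1 \<in> SU3" by (simp add: SU3_def)
  then have "(\<lambda>t. mat 1 ** t) ` max_torus \<in> {(\<lambda>t. g ** t) ` max_torus | g. g \<in> SU3}"
    by (intro CollectI exI[of _ "mat 1"] conjI refl)
  then show ?thesis by (rule exI)
qed

definition flag_base :: flag where
  "flag_base = flag_of_coset max_torus"

definition flag_act :: "complex^3^3 \<Rightarrow> flag \<Rightarrow> flag" where
  "flag_act g z = flag_of_coset ((\<lambda>h. g ** h) ` coset_of_flag z)"

text \<open>Quotient topology of \<open>SU(3)/T\<close>.\<close>

instantiation flag :: topological_space
begin
definition "open (U :: flag set) \<longleftrightarrow>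
  openin (top_of_set SU3) {g \<in> SU3. flag_act g flag_base \<in> U}"
instance
proof
  show "open (UNIV :: flag set)"
    unfolding open_flag_def by simp
  show "open (S \<inter> T)" if "open S" "open T" for S T :: "flag set"
  proof -
    have eq: "{g \<in> SU3. flag_act g flag_base \<in> S \<inter> T} =
        {g \<in> SU3. flag_act g flag_base \<in> S} \<inter> {g \<in> SU3. flag_act g flag_base \<in> T}" by blast
    show ?thesis
      using that unfolding open_flag_def eq by (rule openin_Int)
  qed
  show "open (\<Union>K)" if "\<forall>S\<in>K. open S" for K :: "flag set set"
  proof -
    have eq: "{g \<in> SU3. flag_act g flag_base \<in> \<Union>K} =
        \<Union> ((\<lambda>S. {g \<in> SU3. flag_act g flag_base \<in> S}) ` K)" by blast
    show ?thesis
      using that unfolding open_flag_def eq by (intro openin_Union) blast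
  qed
qed
end

primrec Ck_on :: "nat \<Rightarrow> ('a::real_normed_vector \<Rightarrow> 'b::real_normed_vector) \<Rightarrow> 'a set \<Rightarrow> bool" where
  "Ck_on 0 f U \<longleftrightarrow> continuous_on U f"
| "Ck_on (Suc k) f U \<longleftrightarrow> (\<forall>x\<in>U. f differentiable (at x)) \<and>
     (\<forall>v. Ck_on k (\<lambda>x. frechet_derivative f (at x) v) U)"

text \<open>A function on \<open>SU(3)/T\<close> is smooth iff its pullback to \<open>SU(3)\<close> is; a function on the embedded
  submanifold \<open>SU(3)\<close> of the matrix space is smooth iff it has local smooth extensions.\<close>

definition smooth_flag :: "(flag \<Rightarrow> complex) \<Rightarrow> bool" where
  "smooth_flag f \<longleftrightarrow> (\<forall>g\<in>SU3. \<exists>U F. open U \<and> g \<in> U \<and> (\<forall>k. Ck_on k F U) \<and>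
     (\<forall>h\<in>SU3 \<inter> U. F h = f (flag_act h flag_base)))"

text \<open>The invariant probability measure (it is unique).\<close>

definition is_invariant_measure :: "flag measure \<Rightarrow> bool" where
  "is_invariant_measure \<mu> \<longleftrightarrow> sets \<mu> = sets borel \<and> emeasure \<mu> UNIV = 1 \<and>
     (\<forall>g\<in>SU3. \<forall>A\<in>sets \<mu>. emeasure \<mu> (flag_act g ` A) = emeasure \<mu> A)"

section \<open>Harmonics and symbol correspondences\<close>

fun zero_weight :: "irrep \<Rightarrow> gt_weight" where
  "zero_weight (a, b) = (let c = (int a + 2 * int b) div 3 in (c, c, c))"

fun zero_spin :: "irrep \<Rightarrow> nat \<Rightarrow> real" where
  "zero_spin (a, b) \<gamma> = real \<gamma> - 1 + \<bar>real a - real b\<bar> / 3"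

fun zero_mult :: "irrep \<Rightarrow> nat" where
  "zero_mult (a, b) = min a b + 1"

text \<open>\<open>\<pi>\<close>, \<open>e\<close> is a realization of the irrep \<open>a\<close> with a GT basis.  The value does not depend on the
  representative \<open>g\<close> of \<open>z = g z\<^sub>0\<close>, since \<open>T\<close> fixes the zero weight vectors.\<close>

definition harmonic ::
  "'v::complex_inner_space action \<Rightarrow> (gt_label \<Rightarrow> 'v) \<Rightarrow> irrep \<Rightarrow> nat \<Rightarrow> gt_label \<Rightarrow> flag \<Rightarrow> complex" where
  "harmonic \<pi> e a \<gamma> l z = complex_of_real (sqrt (irrep_dim a)) *
     cnj (wigner_D \<pi> e l (zero_weight a, zero_spin a \<gamma>) (SOME g. g \<in> SU3 \<and> flag_act g flag_base = z))"

definition is_symbol_correspondence ::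
  "irrep \<Rightarrow> (complex^3^3 \<Rightarrow> complex^'n^'n) \<Rightarrow> flag measure \<Rightarrow> (complex^'n^'n \<Rightarrow> flag \<Rightarrow> complex) \<Rightarrow> bool"
  where
  "is_symbol_correspondence p \<rho> \<mu> W \<longleftrightarrow>
     (\<forall>A. smooth_flag (W A)) \<and> inj W \<and>
     (\<forall>A B z. W (A + B) z = W A z + W B z) \<and>
     (\<forall>c A z. W (c *\<^sub>C A) z = c * W A z) \<and>
     (\<forall>g\<in>SU3. \<forall>A z. W (conj_act \<rho> g A) z = W A (flag_act (matrix_inv g) z)) \<and>
     (\<forall>A z. W (dagger A) z = cnj (W A z)) \<and>
     (\<forall>A. integral\<^sup>L \<mu> (W A) = trace A / complex_of_real (irrep_dim p))"

text \<open>\<open>Z \<^bold>C(a)\<^sup>\<sigma>\<close>: \<open>\<pi> a\<close>, \<open>\<epsilon> a\<close> realize the irrep \<open>a\<close>, and \<open>c a \<gamma> \<sigma>\<close> is the entry of \<open>\<^bold>C(a)\<close> in row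
  \<open>\<gamma>\<close> and column \<open>\<sigma>\<close>.\<close>

fun ZC ::
  "(irrep \<Rightarrow> 'v::complex_inner_space action) \<Rightarrow> (irrep \<Rightarrow> gt_label \<Rightarrow> 'v) \<Rightarrow>
   (irrep \<Rightarrow> nat \<Rightarrow> nat \<Rightarrow> complex) \<Rightarrow> irrep \<times> nat \<Rightarrow> gt_label \<Rightarrow> flag \<Rightarrow> complex" where
  "ZC \<pi> \<epsilon> c (a, \<sigma>) l z = (\<Sum>\<gamma>=1..zero_mult a. c a \<gamma> \<sigma> * harmonic (\<pi> a) (\<epsilon> a) a \<gamma> l z)"

definition is_characteristic ::
  "irrep \<Rightarrow> (irrep \<Rightarrow> nat) \<Rightarrow> (irrep \<times> nat \<Rightarrow> gt_label \<Rightarrow> complex^'n^'n) \<Rightarrow>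
   (irrep \<Rightarrow> 'v::complex_inner_space action) \<Rightarrow> (irrep \<Rightarrow> gt_label \<Rightarrow> 'v) \<Rightarrow>
   (complex^'n^'n \<Rightarrow> flag \<Rightarrow> complex) \<Rightarrow> (irrep \<Rightarrow> nat \<Rightarrow> nat \<Rightarrow> complex) \<Rightarrow> bool" where
  "is_characteristic p m E \<pi> \<epsilon> W c \<longleftrightarrow>
     (\<forall>(a, \<sigma>)\<in>CG_series m. \<forall>l\<in>GT_labels a.
        W (sqrt (irrep_dim p) *\<^sub>R E (a, \<sigma>) l) = ZC \<pi> \<epsilon> c (a, \<sigma>) l)"

text \<open>Meaningful on the image of the injective map \<open>W\<close>.\<close>

definition twisted_product ::
  "(complex^'n^'n \<Rightarrow> flag \<Rightarrow> complex) \<Rightarrow> (flag \<Rightarrow> complex) \<Rightarrow> (flag \<Rightarrow> complex) \<Rightarrow> (flag \<Rightarrow> complex)"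
  where "twisted_product W f g = W (inv W f ** inv W g)"

lemma twisted_product_symbols:
  "inj W \<Longrightarrow> twisted_product W (W A) (W B) = W (A ** B)"
  by (simp add: twisted_product_def)

end

theory Submission
  imports Defs
begin

text \<open>Expanding the traces \<open>tr(E\<^sup>\<dagger>E\<^sub>1E\<^sub>2)\<close> in the Gelfand-Tsetlin basis of \<open>p\<close> turns matrix elements into
  Clebsch-Gordan coefficients (these are real), and the signs of the dual basis combine to those of
  the Wigner product symbol; this is the product formula, by linearity of \<open>W\<close>.  For the selection
  rules, \<open>sl(3)\<close> acts on operators by commutators, hence by derivations.  So weights add under
  multiplication, and raising a product of U-spins \<open>J\<^sub>1\<close>, \<open>J\<^sub>2\<close> sufficiently often gives \<open>0\<close>; since
  \<open>U\<^sub>+\<close> is adjoint to \<open>U\<^sub>-\<close>, the product has no component of U-spin \<open>J > J\<^sub>1 + J\<^sub>2\<close>.  The other two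
  triangle inequalities follow by cyclicity of the trace.  That the action is the commutator with a
  fixed matrix needs the differentiability of the one-parameter groups, which are only assumed
  continuous.\<close>

section \<open>Orthonormal families and adjoints\<close>

text \<open>\<open>lie_act\<close> is a \<open>vector_derivative\<close>, whose value means
  something only where the derivative exists; so differentiability has to precede any algebra with
  generators. The selection rules are obtained from \<open>T_three\<close>, \<open>U_three\<close>
  and \<open>U_minus\<close> alone: the spin J of a GT label is a U-spin, which
  \<open>U_minus\<close> preserves and \<open>T_minus\<close> mixes. The skew-Hermitian matrices X
  and Y into which these three split have their eigenvalues among 0, i/2 and -i/2, so every
  exponential that occurs has a closed form. A GT basis prescribes lowering operators only. Raising
  is therefore represented by the commutator with the adjoint matrix, and what it does to a basis
  vector is found by pairing the result with the entire coupled basis. No raising coefficients are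
  computed: it is enough that J - u + 1 raisings give 0, because the weights u cancel when the
  resulting bounds are compared.\<close>

lemma cscale_nth [simp]: "(c *\<^sub>C v) $ i = c *\<^sub>C (v $ i)"
  by (simp add: cscale_vec_def)

lemma cinner_add_left: "cinner (x + y) z = cinner x z + cinner y z"
  by (metis cinner_add_right cinner_commute complex_cnj_add)

lemma cinner_cscale_left: "cinner (c *\<^sub>C x) y = cnj c * cinner x y"
  by (metis cinner_cscale_right cinner_commute complex_cnj_mult)

lemma cinner_scaleR_right: "cinner x (r *\<^sub>R y) = of_real r * cinner x y"
  by (simp add: scaleR_conv_cscale cinner_cscale_right)

lemma cinner_scaleR_left: "cinner (r *\<^sub>R x) y = of_real r * cinner x y"
  by (simp add: scaleR_conv_cscale cinner_cscale_left)

lemma cinner_zero_right [simp]: "cinner x 0 = 0"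
  using cinner_cscale_right[of x 0 0] by (simp del: complex_vector.scale_zero_right)

lemma cinner_zero_left [simp]: "cinner 0 x = 0"
  by (metis cinner_commute cinner_zero_right complex_cnj_zero)

lemma cinner_minus_right: "cinner x (- y) = - cinner x y"
  using cinner_scaleR_right[of x "-1" y] by simp

lemma cinner_minus_left: "cinner (- x) y = - cinner x y"
  using cinner_scaleR_left[of "-1" x y] by simp

lemma cinner_diff_right: "cinner x (y - z) = cinner x y - cinner x z"
  using cinner_add_right[of x y "- z"] by (simp add: cinner_minus_right)

lemma cinner_diff_left: "cinner (x - y) z = cinner x z - cinner y z"
  using cinner_add_left[of x "- y" z] by (simp add: cinner_minus_left)

lemma cinner_sum_right: "cinner x (sum f S) = (\<Sum>s\<in>S. cinner x (f s))"
  by (induction S rule: infinite_finite_induct) (simp_all add: cinner_add_right)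

lemma cinner_eq_zero_iff: "cinner x x = 0 \<longleftrightarrow> x = 0"
  by (metis Re_cinner cinner_zero_right inner_eq_zero_iff zero_complex.sel(1))

lemma orthonormal_expansion:
  assumes "finite S" "\<And>s s'. s \<in> S \<Longrightarrow> s' \<in> S \<Longrightarrow> cinner (f s) (f s') = (if s = s' then 1 else 0)"
    and "x \<in> cspan (f ` S)"
  shows "x = (\<Sum>s\<in>S. cinner (f s) x *\<^sub>C f s)"
  using assms(3)
proof (induction rule: complex_vector.span_induct_alt)
  case base
  show ?case by simp
next
  case (step c x y)
  then obtain s where s: "s \<in> S" "x = f s" by blast
  have "(\<Sum>s'\<in>S. cinner (f s') x *\<^sub>C f s') = (\<Sum>s'\<in>S. if s' = s then f s else 0)"
    using s assms(2) by (intro sum.cong) auto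
  then have "(\<Sum>s'\<in>S. cinner (f s') x *\<^sub>C f s') = x" using s assms(1) by simp
  then have "c *\<^sub>C x + y = c *\<^sub>C (\<Sum>s'\<in>S. cinner (f s') x *\<^sub>C f s') +
      (\<Sum>s'\<in>S. cinner (f s') y *\<^sub>C f s')"
    using step by simp
  also have "\<dots> = (\<Sum>s'\<in>S. cinner (f s') (c *\<^sub>C x + y) *\<^sub>C f s')"
    by (simp add: complex_vector.scale_sum_right sum.distrib cinner_add_right cinner_cscale_right
        cscale_add_left)
  finally show ?case .
qed

lemma parseval:
  assumes "finite S" "\<And>s s'. s \<in> S \<Longrightarrow> s' \<in> S \<Longrightarrow> cinner (f s) (f s') = (if s = s' then 1 else 0)"
    and "y \<in> cspan (f ` S)"
  shows "cinner x y = (\<Sum>s\<in>S. cinner x (f s) * cinner (f s) y)"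
  by (subst orthonormal_expansion[OF assms])
    (simp_all add: cinner_sum_right cinner_cscale_right mult.commute)

text \<open>Orthonormal vectors are linearly independent, and the space is finite-dimensional. This
  is what bounds the Clebsch-Gordan series, whose multiplicity function \<open>m\<close> lives on an
  infinite set of irreps.\<close>

lemma finite_orthonormal:
  fixes f :: "'s \<Rightarrow> 'v::{complex_inner_space,euclidean_space}"
  assumes "\<And>s s'. s \<in> S \<Longrightarrow> s' \<in> S \<Longrightarrow> cinner (f s) (f s') = (if s = s' then 1 else 0)"
  shows "finite S"
proof -
  have inj: "inj_on f S" using assms by (metis inj_onI zero_neq_one)
  have "pairwise orthogonal (f ` S)"
    unfolding pairwise_def orthogonal_def Re_cinner[symmetric] using assms by auto
  moreover have "0 \<notin> f ` S" using assms by (metis cinner_zero_left imageE zero_neq_one)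
  ultimately have "independent (f ` S)" by (rule pairwise_orthogonal_independent)
  then have "finite (f ` S)" using independent_bound by blast
  then show ?thesis using inj finite_image_iff by blast
qed

section \<open>Adjoints of matrices and the trace inner product\<close>

lemma dagger_nth [simp]: "dagger A $ i $ j = cnj (A $ j $ i)"
  by (simp add: dagger_def)

lemma dagger_dagger [simp]: "dagger (dagger A) = A"
  by (simp add: vec_eq_iff)

lemma dagger_mult: "dagger (A ** B) = dagger B ** dagger A"
  by (simp add: vec_eq_iff matrix_matrix_mult_def mult.commute)

lemma dagger_add: "dagger (A + B) = dagger A + dagger B"
  by (simp add: vec_eq_iff)

lemma dagger_diff: "dagger (A - B) = dagger A - dagger B"
  by (simp add: vec_eq_iff)

lemma dagger_minus: "dagger (- A) = - dagger A"
  by (simp add: vec_eq_iff)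

lemma dagger_cscale: "dagger (c *\<^sub>C A) = cnj c *\<^sub>C dagger A"
  by (simp add: vec_eq_iff cscale_complex_def)

lemma dagger_scaleR: "dagger (r *\<^sub>R A) = r *\<^sub>R dagger A"
  by (simp add: vec_eq_iff)

lemma dagger_zero [simp]: "dagger 0 = 0"
  by (simp add: vec_eq_iff)

lemma dagger_mat_1 [simp]: "dagger (mat 1) = mat 1"
  by (auto simp: vec_eq_iff mat_def)

lemma matrix_add_rdistrib: "(B + C) ** A = B ** A + (C :: 'a::semiring_1^'n^'m) ** A"
  by (simp add: vec_eq_iff matrix_matrix_mult_def algebra_simps sum.distrib)

lemma matrix_sub_ldistrib: "A ** (B - C) = A ** B - A ** (C :: 'a::ring_1^'n^'m)"
  by (simp add: vec_eq_iff matrix_matrix_mult_def algebra_simps sum_subtractf)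

lemma matrix_sub_rdistrib: "(B - C) ** A = B ** A - (C :: 'a::ring_1^'n^'m) ** A"
  by (simp add: vec_eq_iff matrix_matrix_mult_def algebra_simps sum_subtractf)

lemma matrix_minus_left: "(- A) ** B = - (A ** B :: 'a::ring_1^'n^'m)"
  by (simp add: vec_eq_iff matrix_matrix_mult_def sum_negf)

lemma matrix_minus_right: "A ** (- B) = - (A ** B :: 'a::ring_1^'n^'m)"
  by (simp add: vec_eq_iff matrix_matrix_mult_def sum_negf)

lemma matrix_cscale_left: "(c *\<^sub>C A) ** B = c *\<^sub>C (A ** B :: complex^'n^'m)"
  by (simp add: vec_eq_iff matrix_matrix_mult_def cscale_complex_def sum_distrib_left mult.assoc)

lemma matrix_cscale_right: "A ** (c *\<^sub>C B) = c *\<^sub>C (A ** B :: complex^'n^'m)"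
  by (simp add: vec_eq_iff matrix_matrix_mult_def cscale_complex_def sum_distrib_left
      mult.left_commute)

lemma matrix_scaleR_left: "(r *\<^sub>R A) ** B = r *\<^sub>R (A ** B :: complex^'n^'m)"
  by (simp add: scaleR_conv_cscale matrix_cscale_left)

lemma matrix_scaleR_right: "A ** (r *\<^sub>R B) = r *\<^sub>R (A ** B :: complex^'n^'m)"
  by (simp add: scaleR_conv_cscale matrix_cscale_right)

lemma cinner_matrix_vector: "cinner (A *v x) y = cinner x (dagger A *v (y :: complex^'n))"
  unfolding cinner_vec_def matrix_vector_mult_def cinner_complex_def
  by (simp add: sum_distrib_left sum_distrib_right mult.assoc)
    (subst sum.swap, simp add: mult.left_commute mult.commute)

lemma cinner_eq_trace: "cinner A B = trace (dagger A ** B)"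
  unfolding cinner_vec_def cinner_complex_def trace_def matrix_matrix_mult_def
  by (simp, subst sum.swap, simp)

lemma cinner_mult_left: "cinner C (A ** B) = cinner (dagger A ** C) B"
  by (simp add: cinner_eq_trace dagger_mult matrix_mul_assoc)

lemma cinner_mult_right: "cinner C (A ** B) = cinner (C ** dagger B) A"
  unfolding cinner_eq_trace dagger_mult by (metis dagger_dagger matrix_mul_assoc trace_mul_sym)

lemma cinner_axis:
  fixes x :: "complex^'n"
  shows "cinner (axis i 1) x = x $ i" "cinner x (axis i 1) = cnj (x $ i)"
proof -
  have "cinner (axis i 1) x = (\<Sum>k\<in>UNIV. if k = i then x $ k else 0)"
    unfolding cinner_vec_def by (rule sum.cong) (auto simp: axis_def cinner_complex_def)
  then show "cinner (axis i 1) x = x $ i" by simp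
  then show "cinner x (axis i 1) = cnj (x $ i)" by (metis cinner_commute)
qed

lemma matrix_vector_axis: "(M *v axis j 1) $ i = (M :: 'a::semiring_1^'n^'m) $ i $ j"
proof -
  have "(M *v axis j 1) $ i = (\<Sum>k\<in>UNIV. if k = j then M $ i $ k else 0)"
    unfolding matrix_vector_mult_def vec_lambda_beta by (rule sum.cong) (auto simp: axis_def)
  then show ?thesis by simp
qed

lemma trace_orthonormal:
  fixes e :: "'s \<Rightarrow> complex^'n"
  assumes "finite S" "\<And>s s'. s \<in> S \<Longrightarrow> s' \<in> S \<Longrightarrow> cinner (e s) (e s') = (if s = s' then 1 else 0)"
    and "cspan (e ` S) = UNIV"
  shows "trace M = (\<Sum>s\<in>S. cinner (e s) (M *v e s))"
proof -
  have par: "cinner x y = (\<Sum>s\<in>S. cinner x (e s) * cinner (e s) y)" for x y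
    by (rule parseval[where f = e, OF assms(1,2)]) (simp_all only: assms(3) UNIV_I)
  have "trace M = (\<Sum>i\<in>UNIV. cinner (axis i 1) (M *v axis i 1))"
    by (simp add: trace_def cinner_axis matrix_vector_axis)
  also have "\<dots> = (\<Sum>i\<in>UNIV. \<Sum>s\<in>S. cinner (axis i 1) (M *v e s) * cinner (e s) (axis i 1))"
  proof (rule sum.cong[OF refl])
    fix i :: 'n
    have "cinner (axis i 1) (M *v axis i 1) = cinner (dagger M *v axis i 1) (axis i 1)"
      by (simp add: cinner_matrix_vector)
    also have "\<dots> = (\<Sum>s\<in>S. cinner (dagger M *v axis i 1) (e s) * cinner (e s) (axis i 1))"
      by (rule par)
    finally show "cinner (axis i 1) (M *v axis i 1)
        = (\<Sum>s\<in>S. cinner (axis i 1) (M *v e s) * cinner (e s) (axis i 1))"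
      by (simp add: cinner_matrix_vector)
  qed
  also have "\<dots> = (\<Sum>s\<in>S. cinner (e s) (M *v e s))"
    unfolding cinner_axis
    by (subst sum.swap) (simp add: cinner_vec_def cinner_complex_def mult.commute)
  finally show ?thesis .
qed

text \<open>Two resolutions of the identity are inserted into the trace of
  \<open>dagger C ** A ** B\<close>, on either side of \<open>A\<close>. The factor of
  \<open>C\<close> stays in conjugated order, the form in which \<open>CG_coeff_eq\<close> produces
  matrix elements.\<close>

lemma cinner_matrix_product_orthonormal:
  fixes e :: "'s \<Rightarrow> complex^'n"
  assumes "finite S" "\<And>s s'. s \<in> S \<Longrightarrow> s' \<in> S \<Longrightarrow> cinner (e s) (e s') = (if s = s' then 1 else 0)"
    and "cspan (e ` S) = UNIV"
  shows "cinner C (A ** B) = (\<Sum>r\<in>S. \<Sum>s\<in>S. \<Sum>t\<in>S.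
    cinner (C *v e t) (e r) * cinner (e r) (A *v e s) * cinner (e s) (B *v e t))"
proof -
  have par: "cinner x y = (\<Sum>s\<in>S. cinner x (e s) * cinner (e s) y)" for x y
    by (rule parseval[where f = e, OF assms(1,2)]) (simp_all only: assms(3) UNIV_I)
  have "cinner C (A ** B) = (\<Sum>t\<in>S. cinner (C *v e t) (A *v (B *v e t)))"
    using trace_orthonormal[OF assms, of "dagger C ** (A ** B)"]
    by (simp add: cinner_eq_trace[of C] cinner_matrix_vector flip: matrix_vector_mul_assoc)
  also have "\<dots> = (\<Sum>t\<in>S. \<Sum>r\<in>S. cinner (C *v e t) (e r) * cinner (e r) (A *v (B *v e t)))"
    by (intro sum.cong refl par)
  also have "\<dots> = (\<Sum>t\<in>S. \<Sum>r\<in>S. \<Sum>s\<in>S.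
      cinner (C *v e t) (e r) * (cinner (e r) (A *v e s) * cinner (e s) (B *v e t)))"
  proof (intro sum.cong refl, goal_cases)
    case (1 t r)
    have "cinner (e r) (A *v (B *v e t)) = cinner (dagger A *v e r) (B *v e t)"
      by (simp add: cinner_matrix_vector)
    also have "\<dots> = (\<Sum>s\<in>S. cinner (dagger A *v e r) (e s) * cinner (e s) (B *v e t))"
      by (rule par)
    finally show ?case by (simp add: cinner_matrix_vector sum_distrib_left)
  qed
  also have "\<dots> = (\<Sum>r\<in>S. \<Sum>t\<in>S. \<Sum>s\<in>S.
      cinner (C *v e t) (e r) * (cinner (e r) (A *v e s) * cinner (e s) (B *v e t)))"
    by (rule sum.swap)
  also have "\<dots> = (\<Sum>r\<in>S. \<Sum>s\<in>S. \<Sum>t\<in>S.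
      cinner (C *v e t) (e r) * (cinner (e r) (A *v e s) * cinner (e s) (B *v e t)))"
    by (rule sum.cong[OF refl], rule sum.swap)
  finally show ?thesis by (simp only: mult.assoc)
qed

section \<open>The Wigner product symbol as a matrix coefficient\<close>

text \<open>The parameters \<open>rm\<close>, \<open>rp\<close> are \<open>r\<^sub>-\<close>, \<open>r\<^sub>+\<close>: for fixed \<open>rm\<close>, \<open>rp\<close> the labels \<open>gt_lab a rm rp n\<close>
  with \<open>rm \<le> n \<le> rp\<close> form one multiplet of U-spin \<open>J = (rp - rm) / 2\<close>, of weights
  \<open>u = (rp + rm) / 2 - n\<close>.\<close>

fun gt_lab :: "irrep \<Rightarrow> int \<Rightarrow> int \<Rightarrow> int \<Rightarrow> gt_label" where
  "gt_lab (p, q) rm rp n =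
     ((int p + 2 * int q - (rp + rm), rp + rm - n, n), real_of_int (rp - rm) / 2)"

fun gt_pattern :: "irrep \<Rightarrow> int \<Rightarrow> int \<Rightarrow> bool" where
  "gt_pattern (p, q) rm rp \<longleftrightarrow> 0 \<le> rm \<and> rm \<le> int q \<and> int q \<le> rp \<and> rp \<le> int p + int q"

lemma GT_labels_iff:
  "l \<in> GT_labels a \<longleftrightarrow> (\<exists>rm rp n. l = gt_lab a rm rp n \<and> gt_pattern a rm rp \<and> rm \<le> n \<and> n \<le> rp)"
  by (cases a) auto

lemma gt_lab_inject:
  "gt_lab a rm rp n = gt_lab a rm' rp' n' \<longleftrightarrow> rm = rm' \<and> rp = rp' \<and> n = n'"
  by (cases a) auto

lemma finite_GT_labels: "finite (GT_labels a)"
proof (cases a)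
  case (Pair p q)
  let ?R = "{0..int p + int q}"
  have "GT_labels a \<subseteq> (\<lambda>(rm, rp, n). gt_lab a rm rp n) ` (?R \<times> ?R \<times> ?R)"
    unfolding Pair GT_labels.simps gt_lab.simps by (force simp: image_iff)
  then show ?thesis by (rule finite_subset) simp
qed

lemma gt_check_involution: "gt_check a (gt_check (irrep_dual a) n) = n"
    "gt_check (irrep_dual a) (gt_check a n) = n"
  by (cases a; cases n; simp)+

lemma gt_check_dual: "gt_check (irrep_dual a) n = gt_check a n"
  by (cases a; cases n; simp)

lemma irrep_dual_involution [simp]: "irrep_dual (irrep_dual a) = a"
  by (cases a) simp

lemma gt_check_GT_labels:
  assumes "(n, J) \<in> GT_labels a"
  shows "(gt_check a n, J) \<in> GT_labels (irrep_dual a)"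
proof (cases a)
  case (Pair p q)
  obtain rm rp k where k: "(n, J) = gt_lab a rm rp k" "gt_pattern a rm rp" "rm \<le> k" "k \<le> rp"
    using assms GT_labels_iff by metis
  let ?s = "int p + int q"
  have "(gt_check a n, J) = gt_lab (irrep_dual a) (?s - rp) (?s - rm) (?s - k)"
    using k(1) Pair by auto
  moreover have "gt_pattern (irrep_dual a) (?s - rp) (?s - rm)" using k(2) Pair by auto
  ultimately show ?thesis using k(3,4) unfolding GT_labels_iff by (metis diff_left_mono)
qed

lemma bij_betw_gt_check:
  "bij_betw (\<lambda>(n, J). (gt_check a n, J)) (GT_labels (irrep_dual a)) (GT_labels a)"
proof (rule bij_betwI[where g = "\<lambda>(n, J). (gt_check a n, J)"])
  show "(\<lambda>(n, J). (gt_check a n, J)) \<in> GT_labels (irrep_dual a) \<rightarrow> GT_labels a"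
    using gt_check_GT_labels[of _ _ "irrep_dual a", unfolded irrep_dual_involution gt_check_dual]
    by (simp add: Pi_iff split_beta del: GT_labels.simps)
  show "(\<lambda>(n, J). (gt_check a n, J)) \<in> GT_labels a \<rightarrow> GT_labels (irrep_dual a)"
    using gt_check_GT_labels by (simp add: Pi_iff split_beta del: GT_labels.simps)
qed (use gt_check_involution[of a] in \<open>auto simp: gt_check_dual\<close>)

section \<open>Signs of GT labels\<close>

lemma gt_sign_of_int: "gt_sign (of_int k) = (if even k then 1 else -1)"
  unfolding gt_sign_def by (simp add: power_int_minus_left)

lemma gt_t_plus_gt_u: "2 * (gt_t (n1, n2, n3) + gt_u (n1, n2, n3)) = of_int (n1 - n3)"
  by (simp add: field_simps)

lemma gt_t_gt_u_check: "gt_t (gt_check a n) = - gt_t n" "gt_u (gt_check a n) = - gt_u n"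
  by (cases n; simp add: field_simps)+

definition gt_parity :: "gt_weight \<Rightarrow> complex" where
  "gt_parity n = gt_sign (2 * (gt_t n + gt_u n))"

text \<open>Passing to the dual label negates the integer 2 (t + u) = n1 - n3, which keeps its
  parity. So the sign of a dual basis vector can be read off from either label.\<close>

lemma gt_parity_check: "gt_parity (gt_check a n) = gt_parity n"
proof (cases n)
  case (fields n1 n2 n3)
  have "gt_parity n = gt_sign (of_int (n1 - n3))"
    unfolding gt_parity_def fields gt_t_plus_gt_u ..
  moreover have "gt_parity (gt_check a n) = gt_sign (of_int (- (n1 - n3)))"
    unfolding gt_parity_def gt_t_gt_u_check fields using gt_t_plus_gt_u[of n1 n2 n3]
    by (intro arg_cong[of _ _ gt_sign]) simp
  ultimately show ?thesis by (simp add: gt_sign_of_int del: of_int_minus of_int_diff)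
qed

lemma gt_parity_square: "gt_parity n * gt_parity n = 1"
proof (cases n)
  case (fields n1 n2 n3)
  show ?thesis unfolding gt_parity_def fields gt_t_plus_gt_u gt_sign_of_int by simp
qed

lemma gt_parity_Reals: "gt_parity n \<in> \<real>"
proof (cases n)
  case (fields n1 n2 n3)
  show ?thesis unfolding gt_parity_def fields gt_t_plus_gt_u gt_sign_of_int by simp
qed

text \<open>The size \<open>k\<close> occurs twice and the contributions of \<open>n\<close> and
  \<open>gt_check a n\<close> cancel, so only the parity of the intermediate label survives.\<close>

lemma gt_sign_symbol:
  "gt_sign (real k + 2 * (gt_t n + gt_u n)) *
     gt_sign (real k + 2 * (gt_t (gt_check a n) + gt_t n' + gt_u (gt_check a n) + gt_u n')) = gt_parity n'"
proof (cases n, cases n')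
  fix n1 n2 n3 m1 m2 m3 assume n: "n = (n1, n2, n3)" "n' = (m1, m2, m3)"
  have *: "real k + 2 * (gt_t n + gt_u n) = of_int (int k + (n1 - n3))"
    "real k + 2 * (gt_t (gt_check a n) + gt_t n' + gt_u (gt_check a n) + gt_u n') =
       of_int (int k - (n1 - n3) + (m1 - m3))"
    "2 * (gt_t n' + gt_u n') = of_int (m1 - m3)"
    unfolding gt_t_gt_u_check unfolding n by (simp_all add: field_simps)
  show ?thesis unfolding gt_parity_def * gt_sign_of_int by auto
qed

text \<open>The operator |v><w| has trace inner product <E w|v> with E. A Clebsch-Gordan coefficient
  is thus a conjugated matrix element of a coupled basis operator, up to the sign of the dual basis
  vector.\<close>

lemma CG_coeff_eq:
  fixes e :: "gt_label \<Rightarrow> complex^'n"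
  shows "CG_coeff p e E x l (n, J) l' = gt_parity n * cinner (E x l' *v e (gt_check p n, J)) (e l)"
proof -
  let ?w = "e (gt_check p n, J)"
  have "tensor_op (e l) (gt_dual_basis p e (n, J)) $ i $ j = gt_parity n * (e l $ i * cnj (?w $ j))" for i j
    unfolding gt_dual_basis.simps gt_parity_def[symmetric] gt_parity_check
    by (simp add: tensor_op_def matrix_def cinner_axis cscale_complex_def)
  then have "CG_coeff p e E x l (n, J) l' =
      (\<Sum>i\<in>UNIV. \<Sum>j\<in>UNIV. cnj (E x l' $ i $ j) * (gt_parity n * (e l $ i * cnj (?w $ j))))"
    by (simp add: CG_coeff_def cinner_vec_def cinner_complex_def)
  also have "\<dots> = gt_parity n * cinner (E x l' *v ?w) (e l)"
    by (simp add: cinner_vec_def cinner_complex_def matrix_vector_mult_def sum_distrib_left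
        sum_distrib_right mult_ac)
  finally show ?thesis .
qed

lemma wigner_symbol_eq_cinner:
  fixes e :: "gt_label \<Rightarrow> complex^'n"
  assumes orth: "\<And>l l'. l \<in> GT_labels p \<Longrightarrow> l' \<in> GT_labels p \<Longrightarrow>
      cinner (e l) (e l') = (if l = l' then 1 else 0)"
    and span: "cspan (e ` GT_labels p) = UNIV"
    and real: "\<And>l l'. l \<in> GT_labels p \<Longrightarrow> l' \<in> GT_labels (irrep_dual p) \<Longrightarrow> CG_coeff p e E x l l' k \<in> \<real>"
      "\<And>l l'. l \<in> GT_labels p \<Longrightarrow> l' \<in> GT_labels (irrep_dual p) \<Longrightarrow> CG_coeff p e E x' l l' k' \<in> \<real>"
  shows "gt_sign (real (irrep_size p) + 2 * (gt_t n + gt_u n)) *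
      wigner_symbol p e E x k x' k' (a, \<sigma>) (gt_check a n, J) =
    cinner (E (a, \<sigma>) (n, J)) (E x k ** E x' k')"
proof -
  let ?L = "GT_labels p" and ?D = "GT_labels (irrep_dual p)"
  define ch where "ch = (\<lambda>(n, J :: real). (gt_check p n, J))"
  define F where "F r s t = cinner (E (a, \<sigma>) (n, J) *v e t) (e r) * cinner (e r) (E x k *v e s) *
     cinner (e s) (E x' k' *v e t)" for r s t
  have bij: "bij_betw ch ?D ?L" unfolding ch_def by (rule bij_betw_gt_check)
  \<comment> \<open>\<open>CG_coeff_eq\<close> yields <A w|v>, whereas the two factors of the
    product occur in the trace as <v|A w>. Reality identifies the two.\<close>
  have flip: "cinner (e r) (A *v e (gt_check p k2, I2)) = gt_parity k2 * CG_coeff p e E y r (k2, I2) k"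
    if "A = E y k" "CG_coeff p e E y r (k2, I2) k \<in> \<real>" for r k2 I2 A y k
  proof -
    have "cinner (A *v e (gt_check p k2, I2)) (e r) = gt_parity k2 * CG_coeff p e E y r (k2, I2) k"
      using gt_parity_square[of k2] by (simp add: CG_coeff_eq that(1) flip: mult.assoc)
    then have "cinner (A *v e (gt_check p k2, I2)) (e r) \<in> \<real>"
      using that(2) gt_parity_Reals by (metis Reals_mult)
    then show ?thesis
      by (metis \<open>cinner (A *v e (gt_check p k2, I2)) (e r) = _\<close> cinner_commute Reals_cnj_iff)
  qed
  let ?s = "gt_sign (real (irrep_size p) + 2 * (gt_t n + gt_u n))"
    and ?s' = "\<lambda>k2. gt_sign (real (irrep_size p) +
      2 * (gt_t (gt_check a n) + gt_t k2 + gt_u (gt_check a n) + gt_u k2))"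
  have summand: "?s * (case s of (k2, I2) \<Rightarrow> case t of (k3, I3) \<Rightarrow>
        ?s' k2 *
        CG_coeff p e E x (k1, I1) (k2, I2) k *
        CG_coeff p e E x' (gt_check (irrep_dual p) k2, I2) (k3, I3) k' *
        CG_coeff p e E (a, \<sigma>) (k1, I1) (k3, I3) (gt_check (irrep_dual a) (gt_check a n), J)) =
      F (k1, I1) (ch s) (ch t)"
    if rst: "(k1, I1) \<in> ?L" "s \<in> ?D" "t \<in> ?D" for k1 I1 s t
  proof -
    obtain k2 I2 k3 I3 where st: "s = (k2, I2)" "t = (k3, I3)" by (metis surj_pair)
    have s': "(gt_check p k2, I2) \<in> ?L"
      using rst(2) bij st by (metis bij_betwE ch_def case_prod_conv)
    have 1: "cinner (e (k1, I1)) (E x k *v e (gt_check p k2, I2)) =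
        gt_parity k2 * CG_coeff p e E x (k1, I1) (k2, I2) k"
      using flip real(1)[OF rst(1,2)] st by simp
    have 2: "cinner (e (gt_check p k2, I2)) (E x' k' *v e (gt_check p k3, I3)) =
        gt_parity k3 * CG_coeff p e E x' (gt_check p k2, I2) (k3, I3) k'"
      using flip real(2)[OF s' rst(3)] st by simp
    have 3: "CG_coeff p e E (a, \<sigma>) (k1, I1) (k3, I3) (n, J) =
        gt_parity k3 * cinner (E (a, \<sigma>) (n, J) *v e (gt_check p k3, I3)) (e (k1, I1))"
      by (rule CG_coeff_eq)
    have "?s * (?s' k2 *
        CG_coeff p e E x (k1, I1) (k2, I2) k *
        CG_coeff p e E x' (gt_check (irrep_dual p) k2, I2) (k3, I3) k' *
        CG_coeff p e E (a, \<sigma>) (k1, I1) (k3, I3) (gt_check (irrep_dual a) (gt_check a n), J))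
      = (?s * ?s' k2) *
        CG_coeff p e E x (k1, I1) (k2, I2) k *
        CG_coeff p e E x' (gt_check p k2, I2) (k3, I3) k' *
        CG_coeff p e E (a, \<sigma>) (k1, I1) (k3, I3) (n, J)"
      by (simp add: gt_check_dual gt_check_involution[unfolded gt_check_dual] mult.assoc)
    \<comment> \<open>Both sides carry the parities of \<open>k2\<close> and \<open>k3\<close> once.
      On the left they come from \<open>gt_sign_symbol\<close> and from the coefficient of
      \<open>(a, \<sigma>)\<close>, on the right from the two flipped factors.\<close>
    also have "\<dots> = F (k1, I1) (ch s) (ch t)"
      unfolding gt_sign_symbol F_def ch_def st case_prod_conv 1 2 3 by simp
    finally show ?thesis by (simp add: st)
  qed
  have "cinner (E (a, \<sigma>) (n, J)) (E x k ** E x' k') = (\<Sum>r\<in>?L. \<Sum>s\<in>?L. \<Sum>t\<in>?L. F r s t)"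
    unfolding F_def by (rule cinner_matrix_product_orthonormal[OF finite_GT_labels orth span])
  also have "\<dots> = (\<Sum>r\<in>?L. \<Sum>s\<in>?D. \<Sum>t\<in>?D. F r (ch s) (ch t))"
    by (simp add: sum.reindex_bij_betw[OF bij, symmetric])
  also have "\<dots> = gt_sign (real (irrep_size p) + 2 * (gt_t n + gt_u n)) *
      wigner_symbol p e E x k x' k' (a, \<sigma>) (gt_check a n, J)"
    unfolding wigner_symbol.simps sum_distrib_left
    by (rule sum.cong[OF refl], clarify, unfold sum_distrib_left, rule sum.cong[OF refl], clarify,
        unfold sum_distrib_left, rule sum.cong[OF refl], clarify)
      (rule summand[symmetric, where s = "(_, _)" and t = "(_, _)", unfolded case_prod_conv])
  finally show ?thesis by simp
qed

section \<open>Commutators as derivations\<close>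

definition commutator :: "complex^'n^'n \<Rightarrow> complex^'n^'n \<Rightarrow> complex^'n^'n" where
  "commutator K A = K ** A - A ** K"

lemma commutator_add_left: "commutator (K + L) A = commutator K A + commutator L A"
  by (simp add: commutator_def matrix_add_ldistrib matrix_add_rdistrib)

lemma commutator_cscale_left: "commutator (c *\<^sub>C K) A = c *\<^sub>C commutator K A"
  by (simp add: commutator_def matrix_cscale_left matrix_cscale_right complex_vector.scale_right_diff_distrib)

lemma commutator_minus_right: "commutator K (- A) = - commutator K A"
  by (simp add: commutator_def matrix_minus_left matrix_minus_right)

lemma commutator_scaleR_right: "commutator K (r *\<^sub>R A) = r *\<^sub>R commutator K A"
  by (simp add: commutator_def matrix_scaleR_left matrix_scaleR_right scaleR_right_diff_distrib)

lemma commutator_add_right: "commutator K (A + B) = commutator K A + commutator K B"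
  by (simp add: commutator_def matrix_add_ldistrib matrix_add_rdistrib)

lemma commutator_zero_right [simp]: "commutator K 0 = 0"
  using commutator_scaleR_right[of K 0 0] by simp

lemma commutator_mult: "commutator K (A ** B) = commutator K A ** B + A ** commutator K B"
  by (simp add: commutator_def matrix_sub_ldistrib matrix_sub_rdistrib matrix_mul_assoc)

lemma cinner_commutator: "cinner A (commutator K B) = cinner (commutator (dagger K) A) B"
  by (simp add: commutator_def cinner_diff_right cinner_diff_left cinner_mult_left[of A K]
      cinner_mult_right[of A B])

lemma dagger_commutator: "dagger (commutator K A) = - commutator (dagger K) (dagger A)"
  by (simp add: commutator_def dagger_diff dagger_mult)

lemma cinner_commutator_power:
  "cinner A ((commutator K ^^ k) B) = cinner ((commutator (dagger K) ^^ k) A) B"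
proof (induction k arbitrary: B)
  case (Suc k)
  have "cinner A ((commutator K ^^ Suc k) B) = cinner A ((commutator K ^^ k) (commutator K B))"
    by (simp add: funpow_swap1)
  then show ?case by (simp add: Suc.IH cinner_commutator)
qed simp

text \<open>Taking adjoints turns \<open>commutator K\<close> into minus
  \<open>commutator (dagger K)\<close>. So the adjoint of a vector killed by k lowerings is killed
  by k raisings; this handles adjoints of basis vectors without their labels in the dual
  irrep.\<close>

lemma dagger_commutator_power_eq_0:
  assumes "(commutator K ^^ k) A = 0"
  shows "(commutator (dagger K) ^^ k) (dagger A) = 0"
proof -
  have "(commutator (dagger K) ^^ k) (dagger A) \<in> {dagger ((commutator K ^^ k) A), - dagger ((commutator K ^^ k) A)}"
    by (induction k) (auto simp: dagger_commutator commutator_minus_right)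
  then show ?thesis using assms by simp
qed

lemma commutator_power_add: "(commutator K ^^ k) (A + B) = (commutator K ^^ k) A + (commutator K ^^ k) B"
  by (induction k) (simp_all add: commutator_add_right)

text \<open>By the Leibniz rule every term of the r-th derivative of \<open>A ** B\<close>
  differentiates \<open>A\<close> at least k times or \<open>B\<close> at least l times, as k + l -
  1 <= r. Peeling off one derivative at a time avoids binomial coefficients.\<close>

lemma commutator_power_mult_eq_0:
  assumes "(commutator K ^^ k) A = 0" "(commutator K ^^ l) B = 0" "k + l \<le> Suc r"
  shows "(commutator K ^^ r) (A ** B) = 0"
  using assms
proof (induction r arbitrary: A B k l)
  case 0
  then have "k = 0 \<or> l = 0" by auto
  with 0 show ?case by (auto simp: matrix_matrix_mult_def vec_eq_iff)
next
  case (Suc r)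
  show ?case
  proof (cases "k = 0 \<or> l = 0")
    case True
    then have "A ** B = 0" using Suc.prems by (auto simp: matrix_matrix_mult_def vec_eq_iff)
    moreover have "(commutator K ^^ n) 0 = 0" for n by (induction n) simp_all
    ultimately show ?thesis by metis
  next
    case False
    then obtain k' l' where kl: "k = Suc k'" "l = Suc l'" by (metis not0_implies_Suc)
    have "(commutator K ^^ r) (commutator K A ** B) = 0"
      by (rule Suc.IH[of k' _ l]) (use Suc.prems kl in \<open>simp_all add: funpow_swap1\<close>)
    moreover have "(commutator K ^^ r) (A ** commutator K B) = 0"
      by (rule Suc.IH[of k _ l']) (use Suc.prems kl in \<open>simp_all add: funpow_swap1\<close>)
    ultimately show ?thesis
      by (simp add: funpow_swap1 commutator_mult commutator_power_add)
  qed
qed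

lemma cinner_lowered_mult_eq_0:
  assumes "(commutator (dagger K) ^^ k) A = 0" "(commutator (dagger K) ^^ l) B = 0" "k + l \<le> Suc r"
  shows "cinner ((commutator K ^^ r) C) (A ** B) = 0"
  using cinner_commutator_power[of C r "dagger K" "A ** B"] commutator_power_mult_eq_0[OF assms] by simp

section \<open>Differentiability of one-parameter groups\<close>

lemma bounded_bilinear_matrix_mult:
  "bounded_bilinear ((**) :: complex^'n^'n \<Rightarrow> complex^'n^'n \<Rightarrow> complex^'n^'n)"
  unfolding bilinear_conv_bounded_bilinear[symmetric] bilinear_def linear_iff
  by (simp add: matrix_add_ldistrib matrix_add_rdistrib matrix_scaleR_left matrix_scaleR_right)

lemma bounded_linear_dagger: "bounded_linear (dagger :: complex^'n^'n \<Rightarrow> complex^'n^'n)"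
  unfolding linear_conv_bounded_linear[symmetric] linear_iff by (simp add: dagger_add dagger_scaleR)

lemma tendsto_det:
  fixes F :: "'a \<Rightarrow> complex^'n^'n"
  assumes "(F \<longlongrightarrow> A) G"
  shows "((\<lambda>x. det (F x)) \<longlongrightarrow> det A) G"
  unfolding det_def by (intro tendsto_intros assms)

lemma has_vector_derivative_at_0_tendsto:
  assumes "(f has_vector_derivative D) (at 0)"
  shows "((\<lambda>h. (f h - f 0) /\<^sub>R h) \<longlongrightarrow> D) (at 0)"
proof -
  have "((\<lambda>h. norm (f h - f 0 - h *\<^sub>R D) / norm h) \<longlongrightarrow> 0) (at 0)"
    using assms by (simp add: has_vector_derivative_def has_derivative_at)
  also have "?this \<longleftrightarrow> ((\<lambda>h. norm ((f h - f 0) /\<^sub>R h - D)) \<longlongrightarrow> 0) (at 0)"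
  proof (intro filterlim_cong refl eventually_at_filter[THEN iffD2] always_eventually allI impI)
    fix h :: real assume "h \<noteq> 0"
    then have "(f h - f 0) /\<^sub>R h - D = (f h - f 0 - h *\<^sub>R D) /\<^sub>R h"
      by (simp add: scaleR_right_diff_distrib)
    then show "norm (f h - f 0 - h *\<^sub>R D) / norm h = norm ((f h - f 0) /\<^sub>R h - D)"
      by (simp add: divide_inverse mult.commute)
  qed
  finally show ?thesis by (simp add: tendsto_norm_zero_iff flip: Lim_null)
qed

text \<open>Averaging over a short interval gives an invertible matrix \<open>M\<close> for which \<open>\<phi> t ** M\<close> is an
  integral, hence differentiable in \<open>t\<close>.\<close>

lemma continuous_one_parameter_differentiable:
  fixes \<phi> :: "real \<Rightarrow> complex^'n^'n"
  assumes cont: "continuous_on UNIV \<phi>" and hom: "\<And>s t. \<phi> (s + t) = \<phi> s ** \<phi> t" and "\<phi> 0 = mat 1"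
  shows "\<exists>D. (\<phi> has_vector_derivative D) (at 0)"
proof -
  interpret mm: bounded_bilinear "(**) :: complex^'n^'n \<Rightarrow> complex^'n^'n \<Rightarrow> complex^'n^'n"
    by (rule bounded_bilinear_matrix_mult)
  have cont': "continuous_on S \<phi>" for S using cont continuous_on_subset by blast
  have int: "\<phi> integrable_on {a..b}" for a b by (rule integrable_continuous_real[OF cont'])
  \<comment> \<open>Starting the integral at -1 makes 0 an interior point, where
    \<open>\<Psi>\<close> has a two-sided derivative.\<close>
  define \<Psi> where "\<Psi> u = integral {-1..u} \<phi>" for u
  have \<Psi>: "(\<Psi> has_vector_derivative \<phi> u) (at u)" if "-1 < u" "u < 2" for u
  proof -
    have "(\<Psi> has_vector_derivative \<phi> u) (at u within {-1..2})"
      unfolding \<Psi>_def using that by (intro integral_has_vector_derivative cont') auto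
    moreover have "at u within {-1..2} = at u" using that by (intro at_within_interior) simp
    ultimately show ?thesis by simp
  qed
  \<comment> \<open>The averages over [0, h] tend to \<open>\<phi> 0\<close>, the identity, so their
    determinants are nonzero for small h. A positive h is chosen, so that the increments of
    \<open>\<Psi>\<close> are integrals over [t, t + h].\<close>
  have "((\<lambda>h. (\<Psi> h - \<Psi> 0) /\<^sub>R h) \<longlongrightarrow> mat 1) (at 0)"
    using has_vector_derivative_at_0_tendsto[OF \<Psi>[of 0]] \<open>\<phi> 0 = mat 1\<close> by simp
  from tendsto_det[OF this] have "((\<lambda>h. det ((\<Psi> h - \<Psi> 0) /\<^sub>R h)) \<longlongrightarrow> 1) (at 0)"
    by (simp only: det_I)
  then have "((\<lambda>h. det ((\<Psi> h - \<Psi> 0) /\<^sub>R h)) \<longlongrightarrow> 1) (at_right 0)"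
    by (rule filterlim_mono) (simp_all add: at_within_le_at)
  then have "\<forall>\<^sub>F h in at_right 0. det ((\<Psi> h - \<Psi> 0) /\<^sub>R h) \<noteq> 0"
    by (rule tendsto_imp_eventually_ne) simp
  moreover have "\<forall>\<^sub>F h in at_right (0::real). h \<in> {0<..<1}"
    by (rule eventually_at_right_real) simp
  ultimately have "\<forall>\<^sub>F h in at_right 0. det ((\<Psi> h - \<Psi> 0) /\<^sub>R h) \<noteq> 0 \<and> h \<in> {0<..<1}"
    by (rule eventually_conj)
  then obtain h where h: "0 < h" "h < 1" "det ((\<Psi> h - \<Psi> 0) /\<^sub>R h) \<noteq> 0"
    using eventually_happens[of _ "at_right (0::real)"] trivial_limit_at_right_real[of 0]
    by (auto simp only: greaterThanLessThan_iff)
  then obtain N where N: "((\<Psi> h - \<Psi> 0) /\<^sub>R h) ** N = mat 1"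
    using invertible_det_nz unfolding invertible_def by blast
  have diff: "\<Psi> (t + h) - \<Psi> t = \<phi> t ** (\<Psi> h - \<Psi> 0)" if t: "-1 < t" for t
  proof -
    have split: "\<Psi> (s + h) - \<Psi> s = integral {s..s+h} \<phi>" if "-1 < s" for s
      unfolding \<Psi>_def using Henstock_Kurzweil_Integration.integral_combine[OF _ _ int, of "-1" s "s + h"] that h by (simp add: algebra_simps)
    have "\<phi> t ** integral {0..h} \<phi> = integral {0..h} (\<lambda>s. \<phi> t ** \<phi> s)"
      using integral_linear[OF int mm.bounded_linear_right, of 0 h "\<phi> t"] by (simp add: o_def)
    also have "\<dots> = integral {0..h} (\<phi> \<circ> (+) t)" by (simp add: o_def hom)
    also have "\<dots> = integral {t..t+h} \<phi>" by (simp add: integral_shift_Icc_real add.commute)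
    finally show ?thesis using split[OF t] split[of 0] by simp
  qed
  have eq: "\<phi> t = ((\<Psi> (t + h) - \<Psi> t) /\<^sub>R h) ** N" if "-1 < t" for t
    using arg_cong[OF N, of "(**) (\<phi> t)"]
    by (simp add: diff[OF that] mm.scaleR_right matrix_scaleR_left matrix_mul_assoc)
  have "((\<lambda>t. \<Psi> (t + h)) has_vector_derivative \<phi> h) (at 0)"
  proof -
    have "((\<lambda>t. t + h) has_vector_derivative 1) (at 0)" by (auto intro!: derivative_eq_intros)
    then show ?thesis
      using vector_diff_chain_at[of "\<lambda>t. t + h" 1 0 \<Psi> "\<phi> h"] \<Psi>[of h] h by (simp add: o_def)
  qed
  then have "((\<lambda>t. ((\<Psi> (t + h) - \<Psi> t) /\<^sub>R h) ** N) has_vector_derivative ((\<phi> h - \<phi> 0) /\<^sub>R h) ** N) (at 0)"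
    by (intro bounded_linear.has_vector_derivative[OF mm.bounded_linear_left]
        bounded_linear.has_vector_derivative[OF bounded_linear_scaleR_right]
        has_vector_derivative_diff \<Psi>) simp_all
  then have "(\<phi> has_vector_derivative ((\<phi> h - \<phi> 0) /\<^sub>R h) ** N) (at 0)"
    by (rule has_vector_derivative_transform_within_open[where S = "{-1<..}"]) (simp_all add: eq)
  then show ?thesis ..
qed

section \<open>The infinitesimal action on operators\<close>

text \<open>The half-integral spin matrices satisfy \<open>X\<^sup>3 = - X / 4\<close>, so their exponential series collapses to
  the Rodrigues formula.\<close>

lemma mat_exp_cubic:
  fixes X :: "complex^'n^'n"
  assumes X3: "X ** X ** X = (-1/4) *\<^sub>R X"
  shows "mat_exp (t *\<^sub>R X) = mat 1 + (2 * sin (t/2)) *\<^sub>R X + (4 * (1 - cos (t/2))) *\<^sub>R (X ** X)"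
proof -
  \<comment> \<open>X^(2j) = -4 (-1/4)^j X^2 holds only for j >= 1; the extra term at k = 0 cancels
    the cosine term there and restores the identity. The angle is t/2 because the nonzero
    eigenvalues of \<open>X\<close> can only be i/2 and -i/2.\<close>
  have step: "(1 / fact k) *\<^sub>R (((**) (t *\<^sub>R X) ^^ k) (mat 1)) =
      (if k = 0 then mat 1 + 4 *\<^sub>R (X ** X) else 0) + (2 * (sin_coeff k *\<^sub>R (t/2) ^ k)) *\<^sub>R X
        - (4 * (cos_coeff k *\<^sub>R (t/2) ^ k)) *\<^sub>R (X ** X)" for k
  proof (induction k)
    case 0
    show ?case by simp
  next
    case (Suc k)
    have "(1 / fact (Suc k)) *\<^sub>R (((**) (t *\<^sub>R X) ^^ Suc k) (mat 1)) =
      (t / real (Suc k)) *\<^sub>R (X ** ((1 / fact k) *\<^sub>R (((**) (t *\<^sub>R X) ^^ k) (mat 1))))"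
      by (simp add: matrix_scaleR_left matrix_scaleR_right del: of_nat_Suc)
    also have "X ** ((1 / fact k) *\<^sub>R (((**) (t *\<^sub>R X) ^^ k) (mat 1))) =
      (2 * (sin_coeff k *\<^sub>R (t/2) ^ k)) *\<^sub>R (X ** X) + (cos_coeff k *\<^sub>R (t/2) ^ k) *\<^sub>R X"
      unfolding Suc.IH using X3
      by (simp add: matrix_add_ldistrib matrix_sub_ldistrib matrix_scaleR_right matrix_mul_assoc)
    also have "(t / real (Suc k)) *\<^sub>R \<dots> = (2 * (sin_coeff (Suc k) *\<^sub>R (t/2) ^ Suc k)) *\<^sub>R X
        - (4 * (cos_coeff (Suc k) *\<^sub>R (t/2) ^ Suc k)) *\<^sub>R (X ** X)"
    proof -
      have "t / real (Suc k) * (2 * (sin_coeff k *\<^sub>R (t/2) ^ k)) = - (4 * (cos_coeff (Suc k) *\<^sub>R (t/2) ^ Suc k))"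
        "t / real (Suc k) * (cos_coeff k *\<^sub>R (t/2) ^ k) = 2 * (sin_coeff (Suc k) *\<^sub>R (t/2) ^ Suc k)"
        by (simp_all add: sin_coeff_Suc cos_coeff_Suc del: of_nat_Suc)
      then show ?thesis by (simp only: scaleR_add_right scaleR_scaleR) simp
    qed
    finally show ?case by simp
  qed
  have "(\<lambda>k. (if k = 0 then mat 1 + 4 *\<^sub>R (X ** X) else 0) + (2 * (sin_coeff k *\<^sub>R (t/2) ^ k)) *\<^sub>R X
        - (4 * (cos_coeff k *\<^sub>R (t/2) ^ k)) *\<^sub>R (X ** X))
      sums ((mat 1 + 4 *\<^sub>R (X ** X)) + (2 * sin (t/2)) *\<^sub>R X - (4 * cos (t/2)) *\<^sub>R (X ** X))"
    by (intro sums_diff sums_add sums_scaleR_left sums_mult sin_converges cos_converges)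
      (rule sums_single)
  then have "mat_exp (t *\<^sub>R X) = (mat 1 + 4 *\<^sub>R (X ** X)) + (2 * sin (t/2)) *\<^sub>R X - (4 * cos (t/2)) *\<^sub>R (X ** X)"
    unfolding mat_exp_def step by (rule sums_unique[symmetric])
  then show ?thesis by (simp add: algebra_simps)
qed

text \<open>The span of 1, X and X^2 is closed under multiplication, so comparing coefficients
  leaves the addition formulas of sine and cosine.\<close>

lemma mat_exp_cubic_add:
  fixes X :: "complex^'n^'n"
  assumes X3: "X ** X ** X = (-1/4) *\<^sub>R X"
  shows "mat_exp ((s + t) *\<^sub>R X) = mat_exp (s *\<^sub>R X) ** mat_exp (t *\<^sub>R X)"
proof -
  have X4: "X ** X ** X ** X = (-1/4) *\<^sub>R (X ** X)"
    unfolding X3 by (rule matrix_scaleR_left)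
  have mult: "(mat 1 + a *\<^sub>R X + b *\<^sub>R (X ** X)) ** (mat 1 + a' *\<^sub>R X + b' *\<^sub>R (X ** X)) =
    mat 1 + (a + a' - (a * b' + b * a') / 4) *\<^sub>R X + (b + b' + a * a' - b * b' / 4) *\<^sub>R (X ** X)"
    for a b a' b'
    by (simp add: matrix_add_ldistrib matrix_add_rdistrib matrix_scaleR_left matrix_scaleR_right
        matrix_sub_ldistrib matrix_sub_rdistrib matrix_mul_assoc X3 X4) (simp add: algebra_simps add_divide_distrib)
  have "2 * sin ((s + t) / 2) = 2 * sin (s/2) + 2 * sin (t/2) -
      (2 * sin (s/2) * (4 * (1 - cos (t/2))) + 4 * (1 - cos (s/2)) * (2 * sin (t/2))) / 4"
    "4 * (1 - cos ((s + t) / 2)) = 4 * (1 - cos (s/2)) + 4 * (1 - cos (t/2)) +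
      2 * sin (s/2) * (2 * sin (t/2)) - 4 * (1 - cos (s/2)) * (4 * (1 - cos (t/2))) / 4"
  proof -
    \<comment> \<open>\<open>a\<close>, \<open>b\<close> stand for the sine and cosine of s/2, and
      \<open>c\<close>, \<open>d\<close> for those of t/2. The identities are polynomial and do not
      involve a^2 + b^2 = 1.\<close>
    have "2 * (a * d + b * c) = 2 * a + 2 * c - (2 * a * (4 * (1 - d)) + 4 * (1 - b) * (2 * c)) / 4"
      "4 * (1 - (b * d - a * c)) =
        4 * (1 - b) + 4 * (1 - d) + 2 * a * (2 * c) - 4 * (1 - b) * (4 * (1 - d)) / 4"
      for a b c d :: real
      by (simp_all add: field_simps)
    then show "2 * sin ((s + t) / 2) = 2 * sin (s/2) + 2 * sin (t/2) -
        (2 * sin (s/2) * (4 * (1 - cos (t/2))) + 4 * (1 - cos (s/2)) * (2 * sin (t/2))) / 4"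
      "4 * (1 - cos ((s + t) / 2)) = 4 * (1 - cos (s/2)) + 4 * (1 - cos (t/2)) +
        2 * sin (s/2) * (2 * sin (t/2)) - 4 * (1 - cos (s/2)) * (4 * (1 - cos (t/2))) / 4"
      unfolding add_divide_distrib[of s t 2] sin_add cos_add by blast+
  qed
  then show ?thesis unfolding mat_exp_cubic[OF X3] mult by (simp only:)
qed

section \<open>Explicit one-parameter subgroups of SU(3)\<close>

text \<open>Modelled on -i times a component of spin 1/2, extended by zero. The determinant is
  required of the exponential itself, where the closed formula reduces it to sin^2 + cos^2 =
  1.\<close>

definition su2_generator :: "complex^3^3 \<Rightarrow> bool" where
  "su2_generator X \<longleftrightarrow> dagger X = - X \<and> X ** X ** X = (-1/4) *\<^sub>R X \<and> (\<forall>t. det (mat_exp (t *\<^sub>R X)) = 1)"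

lemma su2_generator_uminus:
  assumes "su2_generator X"
  shows "su2_generator (- X)"
proof -
  have "det (mat_exp (t *\<^sub>R - X)) = 1" for t
  proof -
    have "t *\<^sub>R - X = (- t) *\<^sub>R X" by simp
    then show ?thesis using assms unfolding su2_generator_def by metis
  qed
  then show ?thesis using assms unfolding su2_generator_def
    by (simp add: dagger_minus matrix_minus_left matrix_minus_right)
qed

lemma su2_generator_SU3:
  assumes "su2_generator X"
  shows "mat_exp (t *\<^sub>R X) \<in> SU3"
proof -
  have X: "dagger X = - X" "X ** X ** X = (-1/4) *\<^sub>R X" "det (mat_exp (t *\<^sub>R X)) = 1"
    using assms by (auto simp: su2_generator_def)
  have "dagger (mat_exp (t *\<^sub>R X)) = mat_exp ((- t) *\<^sub>R X)"
    unfolding mat_exp_cubic[OF X(2)]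
    by (simp add: dagger_add dagger_scaleR dagger_mult X(1) matrix_minus_left matrix_minus_right)
  then have "dagger (mat_exp (t *\<^sub>R X)) ** mat_exp (t *\<^sub>R X) = mat_exp ((- t + t) *\<^sub>R X)"
    unfolding mat_exp_cubic_add[OF X(2)] by simp
  also have "\<dots> = mat 1" using mat_exp_cubic[OF X(2), of 0] by simp
  finally show ?thesis using X(3) by (simp add: SU3_def)
qed

lemma continuous_on_mat_exp_su2:
  assumes "su2_generator X"
  shows "continuous_on S (\<lambda>t. mat_exp (t *\<^sub>R X))"
proof -
  have "X ** X ** X = (-1/4) *\<^sub>R X" using assms by (simp add: su2_generator_def)
  from mat_exp_cubic[OF this] show ?thesis by (simp only:) (intro continuous_intros; simp)
qed

lemma det_cubic_3:
  assumes "X ** X ** X = (-1/4) *\<^sub>R X"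
    and "\<And>s c :: complex. s\<^sup>2 + c\<^sup>2 = 1 \<Longrightarrow> det (mat 1 + (2 * s) *\<^sub>C X + (4 * (1 - c)) *\<^sub>C (X ** X)) = 1"
  shows "det (mat_exp (t *\<^sub>R (X :: complex^3^3))) = 1"
proof -
  have "det (mat 1 + (2 * complex_of_real (sin (t/2))) *\<^sub>C X + (4 * (1 - complex_of_real (cos (t/2)))) *\<^sub>C (X ** X)) = 1"
    by (rule assms(2)) (metis of_real_1 of_real_add of_real_power sin_cos_squared_add)
  then show ?thesis unfolding mat_exp_cubic[OF assms(1)] unfolding scaleR_conv_cscale by simp
qed

text \<open>With X = -i N / 2 one has X^2 = -N^2 / 4, so the closed formula for the exponential
  becomes 1 - i s N + (c - 1) N^2. Allowing all complex s, c with s^2 + c^2 = 1 makes the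
  determinant condition purely algebraic.\<close>

lemma su2_generatorI:
  assumes "dagger N = N" "N ** N ** N = N"
    and "\<And>s c :: complex. s * s + c * c = 1 \<Longrightarrow> det (mat 1 + (- \<i> * s) *\<^sub>C N + (c - 1) *\<^sub>C (N ** N)) = 1"
  shows "su2_generator ((1 / (2 * \<i>)) *\<^sub>C N)"
proof -
  define X where "X = (1 / (2 * \<i>)) *\<^sub>C N"
  have i: "1 / (2 * \<i>) = - \<i> / 2" by (simp add: complex_eq_iff)
  have X: "X = (- \<i> / 2) *\<^sub>C N" unfolding X_def i ..
  have XX: "X ** X = (-1/4) *\<^sub>C (N ** N)"
    by (simp add: X matrix_cscale_left matrix_cscale_right matrix_minus_left matrix_minus_right)
  have X3: "X ** X ** X = (-1/4) *\<^sub>R X"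
    unfolding XX by (simp add: X matrix_cscale_left matrix_cscale_right
        matrix_minus_left matrix_minus_right assms(2) scaleR_conv_cscale)
  have "dagger X = - X" by (simp add: X dagger_minus dagger_cscale assms(1))
  moreover have "det (mat_exp (t *\<^sub>R X)) = 1" for t
  proof (rule det_cubic_3[OF X3])
    fix s c :: complex assume "s\<^sup>2 + c\<^sup>2 = 1"
    moreover have "2 * s * (- \<i> / 2) = - \<i> * s" "4 * (1 - c) * (-1/4) = c - 1"
      by (simp_all add: field_simps)
    ultimately show "det (mat 1 + (2 * s) *\<^sub>C X + (4 * (1 - c)) *\<^sub>C (X ** X)) = 1"
      using assms(3)[of s c] unfolding XX unfolding X cscale_cscale by (simp add: power2_eq_square mult.commute)
  qed
  ultimately show ?thesis using X3 by (simp add: su2_generator_def X_def)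
qed

text \<open>The skew-Hermitian part of a Hermitian Z vanishes, so splitting the diagonal generators
  into Z = X + iY leads to this degenerate case.\<close>

lemma su2_generator_0: "su2_generator 0"
proof -
  have 0: "0 ** 0 ** 0 = (-1/4) *\<^sub>R (0 :: complex^3^3)"
    by (simp add: vec_eq_iff matrix_matrix_mult_def)
  show ?thesis
    using mat_exp_cubic[OF 0, of 0] 0 by (simp add: su2_generator_def dagger_def vec_eq_iff[of _ 0])
qed

text \<open>This is the skew-Hermitian part of Z = E32, written as N / (2i) with N Hermitian so that
  \<open>su2_generatorI\<close> applies; N^2 is the projection onto the last two
  coordinates.\<close>

lemma su2_generator_U_minus_real: "su2_generator ((1 / (2 * \<i>)) *\<^sub>C (\<i> *\<^sub>C (mat_unit 3 2 - mat_unit 2 3)))"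
proof -
  define N where "N = \<i> *\<^sub>C (mat_unit 3 2 - mat_unit 2 3)"
  have N: "N $ i $ j = (if i = 3 \<and> j = 2 then \<i> else if i = 2 \<and> j = 3 then - \<i> else 0)" for i j
    unfolding N_def by (auto simp: mat_unit_def cscale_complex_def)
  have NN: "N ** N = (\<chi> i j. if i = j \<and> i \<noteq> 1 then 1 else 0)"
    unfolding vec_eq_iff forall_3 matrix_matrix_mult_def vec_lambda_beta sum_3 N by simp
  have "su2_generator ((1 / (2 * \<i>)) *\<^sub>C N)"
  proof (rule su2_generatorI)
    show "dagger N = N" unfolding vec_eq_iff forall_3 dagger_nth N by simp
    show "N ** N ** N = N" unfolding NN
      unfolding vec_eq_iff forall_3 matrix_matrix_mult_def vec_lambda_beta sum_3 N by simp
    show "det (mat 1 + (- \<i> * s) *\<^sub>C N + (c - 1) *\<^sub>C (N ** N)) = 1" if "s * s + c * c = 1" for s c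
      unfolding det_3 NN vector_add_component cscale_nth cscale_complex_def mat_def vec_lambda_beta N
      using that by (simp add: algebra_simps)
  qed
  then show ?thesis by (simp only: N_def)
qed

lemma su2_generator_U_minus_imag: "su2_generator ((1 / (2 * \<i>)) *\<^sub>C (mat_unit 3 2 + mat_unit 2 3))"
proof -
  define N where "N = mat_unit 3 2 + mat_unit 2 3"
  have N: "N $ i $ j = (if i = 3 \<and> j = 2 \<or> i = 2 \<and> j = 3 then 1 else 0)" for i j
    unfolding N_def by (auto simp: mat_unit_def cscale_complex_def)
  have NN: "N ** N = (\<chi> i j. if i = j \<and> i \<noteq> 1 then 1 else 0)"
    unfolding vec_eq_iff forall_3 matrix_matrix_mult_def vec_lambda_beta sum_3 N by simp
  have "su2_generator ((1 / (2 * \<i>)) *\<^sub>C N)"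
  proof (rule su2_generatorI)
    show "dagger N = N" unfolding vec_eq_iff forall_3 dagger_nth N by simp
    show "N ** N ** N = N" unfolding NN
      unfolding vec_eq_iff forall_3 matrix_matrix_mult_def vec_lambda_beta sum_3 N by simp
    show "det (mat 1 + (- \<i> * s) *\<^sub>C N + (c - 1) *\<^sub>C (N ** N)) = 1" if "s * s + c * c = 1" for s c
      unfolding det_3 NN vector_add_component cscale_nth cscale_complex_def mat_def vec_lambda_beta N
      using that by (simp add: algebra_simps)
  qed
  then show ?thesis by (simp only: N_def)
qed

lemma su2_generator_T_three: "su2_generator ((1 / (2 * \<i>)) *\<^sub>C (mat_unit 1 1 - mat_unit 2 2))"
proof -
  define N where "N = mat_unit 1 1 - mat_unit 2 2"
  have N: "N $ i $ j = (if i \<noteq> j \<or> i = 3 then 0 else if i = 1 then 1 else - 1)" for i j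
    unfolding N_def using exhaust_3[of i] by (auto simp: mat_unit_def cscale_complex_def)
  have NN: "N ** N = (\<chi> i j. if i = j \<and> i \<noteq> 3 then 1 else 0)"
    unfolding vec_eq_iff forall_3 matrix_matrix_mult_def vec_lambda_beta sum_3 N by simp
  have "su2_generator ((1 / (2 * \<i>)) *\<^sub>C N)"
  proof (rule su2_generatorI)
    show "dagger N = N" unfolding vec_eq_iff forall_3 dagger_nth N by simp
    show "N ** N ** N = N" unfolding NN
      unfolding vec_eq_iff forall_3 matrix_matrix_mult_def vec_lambda_beta sum_3 N by simp
    show "det (mat 1 + (- \<i> * s) *\<^sub>C N + (c - 1) *\<^sub>C (N ** N)) = 1" if "s * s + c * c = 1" for s c
      unfolding det_3 NN vector_add_component cscale_nth cscale_complex_def mat_def vec_lambda_beta N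
      using that by (simp add: algebra_simps)
  qed
  then show ?thesis by (simp only: N_def)
qed

lemma su2_generator_U_three: "su2_generator ((1 / (2 * \<i>)) *\<^sub>C (mat_unit 2 2 - mat_unit 3 3))"
proof -
  define N where "N = mat_unit 2 2 - mat_unit 3 3"
  have N: "N $ i $ j = (if i \<noteq> j \<or> i = 1 then 0 else if i = 2 then 1 else - 1)" for i j
    unfolding N_def using exhaust_3[of i] by (auto simp: mat_unit_def cscale_complex_def)
  have NN: "N ** N = (\<chi> i j. if i = j \<and> i \<noteq> 1 then 1 else 0)"
    unfolding vec_eq_iff forall_3 matrix_matrix_mult_def vec_lambda_beta sum_3 N by simp
  have "su2_generator ((1 / (2 * \<i>)) *\<^sub>C N)"
  proof (rule su2_generatorI)
    show "dagger N = N" unfolding vec_eq_iff forall_3 dagger_nth N by simp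
    show "N ** N ** N = N" unfolding NN
      unfolding vec_eq_iff forall_3 matrix_matrix_mult_def vec_lambda_beta sum_3 N by simp
    show "det (mat 1 + (- \<i> * s) *\<^sub>C N + (c - 1) *\<^sub>C (N ** N)) = 1" if "s * s + c * c = 1" for s c
      unfolding det_3 NN vector_add_component cscale_nth cscale_complex_def mat_def vec_lambda_beta N
      using that by (simp add: algebra_simps)
  qed
  then show ?thesis by (simp only: N_def)
qed

section \<open>Differentiating the conjugation action\<close>

lemma conj_act_unitary:
  assumes "dagger (\<rho> g) ** \<rho> g = mat 1"
  shows "conj_act \<rho> g A = \<rho> g ** A ** dagger (\<rho> g)"
proof -
  have r: "\<rho> g ** dagger (\<rho> g) = mat 1"
    using assms by (rule matrix_left_right_inverse[THEN iffD1])
  have "\<rho> g ** matrix_inv (\<rho> g) = mat 1 \<and> matrix_inv (\<rho> g) ** \<rho> g = mat 1"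
    unfolding matrix_inv_def by (rule someI[of _ "dagger (\<rho> g)"]) (use assms r in blast)
  then have "dagger (\<rho> g) ** (\<rho> g ** matrix_inv (\<rho> g)) = dagger (\<rho> g)" by simp
  then have "matrix_inv (\<rho> g) = dagger (\<rho> g)" by (simp add: matrix_mul_assoc assms)
  then show ?thesis by (simp add: conj_act_def)
qed

locale unitary_matrix_rep =
  fixes \<rho> :: "complex^3^3 \<Rightarrow> complex^'n^'n"
  assumes rep: "unitary_rep UNIV (\<lambda>g v. \<rho> g *v v)"
begin

lemma rho_unitary:
  assumes "g \<in> SU3"
  shows "dagger (\<rho> g) ** \<rho> g = mat 1"
proof -
  have "cinner (\<rho> g *v x) (\<rho> g *v y) = cinner x y" for x y
    using rep assms unfolding unitary_rep_def by blast
  then have "cinner x ((dagger (\<rho> g) ** \<rho> g) *v y) = cinner x y" for x y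
    by (simp add: cinner_matrix_vector flip: matrix_vector_mul_assoc)
  then have "cinner x ((dagger (\<rho> g) ** \<rho> g) *v y - y) = 0" for x y
    by (simp add: cinner_diff_right)
  then have "(dagger (\<rho> g) ** \<rho> g) *v y = y" for y
    using cinner_eq_zero_iff[of "(dagger (\<rho> g) ** \<rho> g) *v y - y"] by simp
  then show ?thesis by (simp add: matrix_eq)
qed

lemma rho_mult: "g \<in> SU3 \<Longrightarrow> h \<in> SU3 \<Longrightarrow> \<rho> (g ** h) = \<rho> g ** \<rho> h"
  using rep unfolding unitary_rep_def matrix_eq by (simp add: matrix_vector_mul_assoc)

lemma rho_one: "\<rho> (mat 1) = mat 1"
  using rep unfolding unitary_rep_def matrix_eq by simp

lemma continuous_on_rho: "continuous_on SU3 \<rho>"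
proof -
  have "continuous_on SU3 (\<lambda>g. (\<rho> g *v axis j 1) $ i)" for i j
    using rep unfolding unitary_rep_def by (intro continuous_intros) simp
  then have "continuous_on SU3 (\<lambda>g. \<rho> g $ i $ j)" for i j by (simp add: matrix_vector_axis)
  then have "continuous_on SU3 (\<lambda>g. \<chi> i j. \<rho> g $ i $ j)" by (intro continuous_on_vec_lambda)
  then show ?thesis by simp
qed

definition gen :: "complex^3^3 \<Rightarrow> complex^'n^'n" where
  "gen X = vector_derivative (\<lambda>t. \<rho> (mat_exp (t *\<^sub>R X))) (at 0)"

lemma gen_has_vector_derivative:
  assumes "su2_generator X"
  shows "((\<lambda>t. \<rho> (mat_exp (t *\<^sub>R X))) has_vector_derivative gen X) (at 0)"
proof -
  have X3: "X ** X ** X = (-1/4) *\<^sub>R X" using assms by (simp add: su2_generator_def)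
  note SU3 = su2_generator_SU3[OF assms]
  have "\<exists>D. ((\<lambda>t. \<rho> (mat_exp (t *\<^sub>R X))) has_vector_derivative D) (at 0)"
  proof (rule continuous_one_parameter_differentiable)
    show "continuous_on UNIV (\<lambda>t. \<rho> (mat_exp (t *\<^sub>R X)))"
      by (rule continuous_on_compose2[OF continuous_on_rho continuous_on_mat_exp_su2[OF assms]])
        (use SU3 in auto)
    show "\<rho> (mat_exp ((s + t) *\<^sub>R X)) = \<rho> (mat_exp (s *\<^sub>R X)) ** \<rho> (mat_exp (t *\<^sub>R X))" for s t
      by (simp add: mat_exp_cubic_add[OF X3] rho_mult SU3)
    show "\<rho> (mat_exp (0 *\<^sub>R X)) = mat 1"
      unfolding mat_exp_cubic[OF X3] by (simp add: rho_one)
  qed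
  then show ?thesis unfolding gen_def vector_derivative_works[symmetric]
    using differentiableI_vector by blast
qed

lemma gen_uminus:
  assumes "su2_generator X"
  shows "gen (- X) = - gen X"
proof -
  have "((\<lambda>t. \<rho> (mat_exp ((- t) *\<^sub>R X))) has_vector_derivative (-1) *\<^sub>R gen X) (at 0)"
    using vector_diff_chain_at[of uminus "-1" 0 "\<lambda>t. \<rho> (mat_exp (t *\<^sub>R X))" "gen X"]
      gen_has_vector_derivative[OF assms] has_vector_derivative_minus[OF has_vector_derivative_id]
    by (simp add: o_def)
  then have "((\<lambda>t. \<rho> (mat_exp (t *\<^sub>R (- X)))) has_vector_derivative - gen X) (at 0)" by simp
  then show ?thesis unfolding gen_def by (rule vector_derivative_at)
qed

text \<open>Differentiate \<open>dagger (\<phi> t) ** \<phi> t = mat 1\<close> at 0, where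
  \<open>\<phi> t\<close> is the unitary one-parameter group generated by \<open>X\<close>.\<close>

lemma dagger_gen:
  assumes "su2_generator X"
  shows "dagger (gen X) = - gen X"
proof -
  let ?\<phi> = "\<lambda>t. \<rho> (mat_exp (t *\<^sub>R X))"
  have X3: "X ** X ** X = (-1/4) *\<^sub>R X" using assms by (simp add: su2_generator_def)
  have d: "(?\<phi> has_vector_derivative gen X) (at 0)" by (rule gen_has_vector_derivative[OF assms])
  have d': "((\<lambda>t. dagger (?\<phi> t)) has_vector_derivative dagger (gen X)) (at 0)"
    by (rule bounded_linear.has_vector_derivative[OF bounded_linear_dagger d])
  have 0: "?\<phi> 0 = mat 1" unfolding mat_exp_cubic[OF X3] by (simp add: rho_one)
  have "((\<lambda>t. dagger (?\<phi> t) ** ?\<phi> t) has_vector_derivative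
      dagger (?\<phi> 0) ** gen X + dagger (gen X) ** ?\<phi> 0) (at 0)"
    by (rule bounded_bilinear.has_vector_derivative[OF bounded_bilinear_matrix_mult d' d])
  then have "((\<lambda>t. mat 1) has_vector_derivative gen X + dagger (gen X)) (at 0)"
    unfolding 0 using rho_unitary[OF su2_generator_SU3[OF assms]] by simp
  then have "gen X + dagger (gen X) = 0"
    by (rule vector_derivative_unique_at) (rule has_vector_derivative_const)
  then show ?thesis by (simp add: add_eq_0_iff)
qed

lemma lie_act_conj_act:
  assumes "su2_generator X"
  shows "lie_act (conj_act \<rho>) X A = commutator (gen X) A"
proof -
  let ?\<phi> = "\<lambda>t. \<rho> (mat_exp (t *\<^sub>R X))"
  have X3: "X ** X ** X = (-1/4) *\<^sub>R X" using assms by (simp add: su2_generator_def)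
  have d: "(?\<phi> has_vector_derivative gen X) (at 0)" by (rule gen_has_vector_derivative[OF assms])
  have d': "((\<lambda>t. dagger (?\<phi> t)) has_vector_derivative dagger (gen X)) (at 0)"
    by (rule bounded_linear.has_vector_derivative[OF bounded_linear_dagger d])
  have 0: "?\<phi> 0 = mat 1" unfolding mat_exp_cubic[OF X3] by (simp add: rho_one)
  have "((\<lambda>t. ?\<phi> t ** A) has_vector_derivative gen X ** A) (at 0)"
    by (rule bounded_linear.has_vector_derivative[OF
          bounded_bilinear.bounded_linear_left[OF bounded_bilinear_matrix_mult] d])
  from bounded_bilinear.has_vector_derivative[OF bounded_bilinear_matrix_mult this d']
  have "((\<lambda>t. ?\<phi> t ** A ** dagger (?\<phi> t)) has_vector_derivative
      ?\<phi> 0 ** A ** dagger (gen X) + gen X ** A ** dagger (?\<phi> 0)) (at 0)" .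
  then have "((\<lambda>t. conj_act \<rho> (mat_exp (t *\<^sub>R X)) A) has_vector_derivative commutator (gen X) A) (at 0)"
    unfolding 0 using rho_unitary[OF su2_generator_SU3[OF assms]]
    by (simp add: conj_act_unitary dagger_gen[OF assms] commutator_def matrix_minus_right)
  then show ?thesis unfolding lie_act_def by (rule vector_derivative_at)
qed

text \<open>Write Z = X + iY with X, Y skew-Hermitian and put K = gen X + i gen Y. Both values of
  \<open>gen\<close> are skew-Hermitian, so the adjoint of K is -gen X + i gen Y, the combination
  that belongs to the adjoint -X + iY of Z.\<close>

lemma sl_act_conj_act:
  assumes "su2_generator ((1/2) *\<^sub>C (Z - dagger Z))" "su2_generator ((1 / (2 * \<i>)) *\<^sub>C (Z + dagger Z))"
  shows "\<exists>K. \<forall>A. sl_act (conj_act \<rho>) Z A = commutator K A \<and>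
    sl_act (conj_act \<rho>) (dagger Z) A = commutator (dagger K) A"
proof -
  define X where "X = (1/2) *\<^sub>C (Z - dagger Z)"
  define Y where "Y = (1 / (2 * \<i>)) *\<^sub>C (Z + dagger Z)"
  have X: "su2_generator X" and Y: "su2_generator Y" unfolding X_def Y_def by (rule assms)+
  define K where "K = gen X + \<i> *\<^sub>C gen Y"
  have K': "dagger K = gen (- X) + \<i> *\<^sub>C gen Y"
    by (simp add: K_def dagger_add dagger_cscale dagger_gen X Y gen_uminus)
  have "sl_act (conj_act \<rho>) Z A = commutator K A" for A
    unfolding sl_act_def X_def[symmetric] Y_def[symmetric] lie_act_conj_act[OF X] lie_act_conj_act[OF Y]
    by (simp add: K_def commutator_add_left commutator_cscale_left)
  moreover have "sl_act (conj_act \<rho>) (dagger Z) A = commutator (dagger K) A" for A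
  proof -
    have "(1/2) *\<^sub>C (dagger Z - dagger (dagger Z)) = - X"
      by (simp add: X_def flip: complex_vector.scale_minus_right)
    moreover have "(1 / (2 * \<i>)) *\<^sub>C (dagger Z + dagger (dagger Z)) = Y"
      by (simp add: Y_def add.commute)
    ultimately show ?thesis
      unfolding sl_act_def K' using lie_act_conj_act[OF su2_generator_uminus[OF X]] lie_act_conj_act[OF Y]
      by (simp add: commutator_add_left commutator_cscale_left)
  qed
  ultimately show ?thesis by blast
qed

lemma dagger_mat_unit: "dagger (mat_unit i j) = mat_unit j i"
  by (auto simp: vec_eq_iff mat_unit_def)

lemma U_minus_conj_act: "\<exists>K. \<forall>A. U_minus (conj_act \<rho>) A = commutator K A"
proof -
  have "(1/2) *\<^sub>C (mat_unit 3 2 - mat_unit 2 3) = (1 / (2 * \<i>)) *\<^sub>C (\<i> *\<^sub>C (mat_unit 3 2 - mat_unit 2 3))"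
    unfolding cscale_cscale by simp
  then have *: "su2_generator ((1/2) *\<^sub>C (mat_unit 3 2 - mat_unit 2 3))"
    by (simp only: su2_generator_U_minus_real)
  have "\<exists>K. \<forall>A. sl_act (conj_act \<rho>) (mat_unit 3 2) A = commutator K A \<and>
      sl_act (conj_act \<rho>) (dagger (mat_unit 3 2)) A = commutator (dagger K) A"
    by (rule sl_act_conj_act; unfold dagger_mat_unit) (rule *, rule su2_generator_U_minus_imag)
  then show ?thesis unfolding U_minus_def by blast
qed

text \<open>Z = N / 2 equals its adjoint, so commutators with \<open>K\<close> and with
  \<open>dagger K\<close> both give its action. Agreement of the commutators, rather than of the
  matrices, is what self-adjointness on operators amounts to.\<close>

lemma hermitian_conj_act:
  assumes "dagger N = N" "su2_generator ((1 / (2 * \<i>)) *\<^sub>C N)"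
  shows "\<exists>K. \<forall>A. sl_act (conj_act \<rho>) ((1/2) *\<^sub>C N) A = commutator K A \<and>
    commutator (dagger K) A = commutator K A"
proof -
  have d: "dagger ((1/2) *\<^sub>C N) = (1/2) *\<^sub>C N" by (simp add: dagger_cscale assms(1))
  have half: "(1/2) *\<^sub>C N + (1/2) *\<^sub>C N = N"
    unfolding cscale_add_left[symmetric] by simp
  have "\<exists>K. \<forall>A. sl_act (conj_act \<rho>) ((1/2) *\<^sub>C N) A = commutator K A \<and>
      sl_act (conj_act \<rho>) (dagger ((1/2) *\<^sub>C N)) A = commutator (dagger K) A"
    by (rule sl_act_conj_act; unfold d half) (simp add: su2_generator_0, rule assms(2))
  then obtain K where K: "\<And>A. sl_act (conj_act \<rho>) ((1/2) *\<^sub>C N) A = commutator K A"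
      "\<And>A. sl_act (conj_act \<rho>) ((1/2) *\<^sub>C N) A = commutator (dagger K) A"
    unfolding d by blast
  show ?thesis by (rule exI[of _ K]) (metis K)
qed

lemma T_three_conj_act:
  "\<exists>K. \<forall>A. T_three (conj_act \<rho>) A = commutator K A \<and> commutator (dagger K) A = commutator K A"
  unfolding T_three_def
  by (rule hermitian_conj_act[OF _ su2_generator_T_three]) (simp add: dagger_diff dagger_mat_unit)

lemma U_three_conj_act:
  "\<exists>K. \<forall>A. U_three (conj_act \<rho>) A = commutator K A \<and> commutator (dagger K) A = commutator K A"
  unfolding U_three_def
  by (rule hermitian_conj_act[OF _ su2_generator_U_three]) (simp add: dagger_diff dagger_mat_unit)

end

text \<open>The commutator is a derivation, so \<open>A ** B\<close> satisfies the eigenvalue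
  equation for a + b; it is self-adjoint, so an eigenvector \<open>C\<close> with a different
  eigenvalue is orthogonal to \<open>A ** B\<close>.\<close>

lemma hermitian_weights_add:
  assumes herm: "\<And>A. commutator (dagger K) A = commutator K A"
    and "commutator K A = complex_of_real a *\<^sub>C A" "commutator K B = complex_of_real b *\<^sub>C B"
    and "commutator K C = complex_of_real c *\<^sub>C C" "cinner C (A ** B) \<noteq> 0"
  shows "c = a + b"
proof -
  have "commutator K (A ** B) = complex_of_real (a + b) *\<^sub>C (A ** B)"
    by (simp add: commutator_mult assms(2,3) matrix_cscale_left matrix_cscale_right cscale_add_left)
  then have "of_real (a + b) * cinner C (A ** B) = cinner C (commutator K (A ** B))"
    by (simp add: cinner_cscale_right)
  also have "\<dots> = of_real c * cinner C (A ** B)"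
    by (simp add: cinner_commutator herm assms(4) cinner_cscale_left)
  finally have "complex_of_real (a + b) = complex_of_real c"
    using assms(5) mult_cancel_right by blast
  then show ?thesis unfolding of_real_eq_iff by simp
qed

section \<open>Selection rules\<close>

text \<open>Increasing n lowers u and runs towards the bottom n = rp of the multiplet. Strictly
  before the bottom both factors under the root are positive; the resulting nonzero constant is what
  \<open>spin_bound\<close> later cancels.\<close>

lemma chain_lower:
  fixes g :: "int \<Rightarrow> complex^'n^'n"
  assumes chain: "\<And>n. rm \<le> n \<Longrightarrow> n \<le> rp \<Longrightarrow>
      commutator K (g n) = sqrt (real_of_int ((rp - n) * (n - rm + 1))) *\<^sub>R g (n + 1)"
    and "rm \<le> n" "n + int k \<le> rp"
  shows "\<exists>c. c \<noteq> 0 \<and> (commutator K ^^ k) (g n) = c *\<^sub>R g (n + int k)"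
  using assms(3)
proof (induction k)
  case 0
  show ?case by (intro exI[of _ 1]) simp
next
  case (Suc k)
  then obtain c where c: "c \<noteq> 0" "(commutator K ^^ k) (g n) = c *\<^sub>R g (n + int k)" by auto
  define s where "s = sqrt (real_of_int ((rp - (n + int k)) * (n + int k - rm + 1)))"
  have "(commutator K ^^ Suc k) (g n) = (c * s) *\<^sub>R g (n + int (Suc k))"
    using Suc.prems assms(2) chain[of "n + int k"]
    by (simp add: c commutator_scaleR_right s_def add.commute add.left_commute)
  moreover have "s > 0"
    unfolding s_def using Suc.prems assms(2) by simp
  ultimately show ?case using c(1) by (intro exI[of _ "c * s"]) auto
qed

lemma chain_lower_eq_0:
  fixes g :: "int \<Rightarrow> complex^'n^'n"
  assumes chain: "\<And>n. rm \<le> n \<Longrightarrow> n \<le> rp \<Longrightarrow>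
      commutator K (g n) = sqrt (real_of_int ((rp - n) * (n - rm + 1))) *\<^sub>R g (n + 1)"
    and n: "rm \<le> n" "n \<le> rp" "rp < n + int k"
  shows "(commutator K ^^ k) (g n) = 0"
proof -
  define j where "j = nat (rp - n)"
  then have j: "n + int j = rp" using n by simp
  obtain c where "(commutator K ^^ j) (g n) = c *\<^sub>R g rp"
    using chain_lower[of rm rp K g n j, OF chain] n j by auto
  \<comment> \<open>At the bottom the factor rp - n is 0, so the value of \<open>g\<close> at rp +
    1, which is not a label, does not matter.\<close>
  then have 0: "(commutator K ^^ Suc j) (g n) = 0"
    using chain[of rp] n by (simp add: commutator_scaleR_right)
  have "k = (k - Suc j) + Suc j" using n(3) j by linarith
  then obtain i where "k = i + Suc j" by blast
  moreover have "(commutator K ^^ i) 0 = 0" by (induction i) simp_all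
  ultimately show ?thesis using 0 by (simp only: funpow_add o_def)
qed

lemma GT_labelsI: "gt_pattern a rm rp \<Longrightarrow> rm \<le> n \<Longrightarrow> n \<le> rp \<Longrightarrow> gt_lab a rm rp n \<in> GT_labels a"
  unfolding GT_labels_iff by blast

text \<open>J + u = rp - k counts the lowerings left to the bottom of the multiplet, and J - u = k -
  rm those made since its top. This turns the radicand of the lowering formula into the integer
  product of \<open>chain_lower\<close>.\<close>

lemma gt_lab_parameters:
  assumes "gt_lab a rm rp k = ((n1, n2, n3), J)"
  shows "n3 = k" "gt_u (n1, n2, n3) = real_of_int (rp + rm - 2 * k) / 2"
    "J = real_of_int (rp - rm) / 2" "gt_lab a rm rp (k + 1) = ((n1, n2 - 1, n3 + 1), J)"
    "J + gt_u (n1, n2, n3) = real_of_int (rp - k)" "J - gt_u (n1, n2, n3) + 1 = real_of_int (k - rm + 1)"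
  using assms by (cases a; auto simp: field_simps)+

lemma is_GT_basis_orthonormal:
  assumes "is_GT_basis a V \<pi> e" "l \<in> GT_labels a" "l' \<in> GT_labels a"
  shows "cinner (e l) (e l') = (if l = l' then 1 else 0)"
  using assms by (cases a) (simp del: GT_labels.simps)

lemma is_GT_basis_weights:
  assumes "is_GT_basis a V \<pi> e" "(\<nu>, J) \<in> GT_labels a"
  shows "T_three \<pi> (e (\<nu>, J)) = complex_of_real (gt_t \<nu>) *\<^sub>C e (\<nu>, J)"
    "U_three \<pi> (e (\<nu>, J)) = complex_of_real (gt_u \<nu>) *\<^sub>C e (\<nu>, J)"
  using assms
  by (cases a; cases \<nu>; simp add: Let_def del: GT_labels.simps gt_t.simps gt_u.simps)+

lemma is_GT_basis_U_minus:
  assumes "is_GT_basis a V \<pi> e" "gt_pattern a rm rp" "rm \<le> n" "n \<le> rp"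
  shows "U_minus \<pi> (e (gt_lab a rm rp n)) =
    sqrt (real_of_int ((rp - n) * (n - rm + 1))) *\<^sub>R e (gt_lab a rm rp (n + 1))"
proof -
  obtain n1 n2 n3 J where l: "gt_lab a rm rp n = ((n1, n2, n3), J)" by (metis surj_pair)
  then have "((n1, n2, n3), J) \<in> GT_labels a" using assms GT_labels_iff by metis
  then have "U_minus \<pi> (e ((n1, n2, n3), J)) = sqrt ((J + gt_u (n1, n2, n3)) * (J - gt_u (n1, n2, n3) + 1)) *\<^sub>R e ((n1, n2 - 1, n3 + 1), J)"
    using assms(1) by (cases a) (simp add: Let_def del: GT_labels.simps gt_t.simps gt_u.simps)
  then show ?thesis
    unfolding gt_lab_parameters(4)[OF l] l gt_lab_parameters(5,6)[OF l] of_int_mult .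
qed

section \<open>The coupled basis as one orthonormal basis of the operator space\<close>

locale coupled_operators = unitary_matrix_rep \<rho>
  for p :: irrep and \<rho> :: "complex^3^3 \<Rightarrow> complex^'n^'n" +
  fixes e :: "gt_label \<Rightarrow> complex^'n" and m :: "irrep \<Rightarrow> nat"
    and E :: "irrep \<times> nat \<Rightarrow> gt_label \<Rightarrow> complex^'n^'n"
  assumes coupled: "is_coupled_basis p \<rho> e m E"
begin

lemma GT_basis_summand:
  assumes "x \<in> CG_series m"
  shows "is_GT_basis (fst x) (cspan (E x ` GT_labels (fst x))) (conj_act \<rho>) (E x)"
proof -
  have "\<forall>(a, \<sigma>)\<in>CG_series m.
      is_irrep a (cspan (E (a, \<sigma>) ` GT_labels a)) (conj_act \<rho>) \<and>
      is_GT_basis a (cspan (E (a, \<sigma>) ` GT_labels a)) (conj_act \<rho>) (E (a, \<sigma>))"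
    using coupled unfolding is_coupled_basis_def by (rule conjunct1)
  then show ?thesis using assms by (simp add: split_beta)
qed

lemma E_orthonormal:
  assumes "x \<in> CG_series m" "l \<in> GT_labels (fst x)" "y \<in> CG_series m" "l' \<in> GT_labels (fst y)"
  shows "cinner (E x l) (E y l') = (if x = y \<and> l = l' then 1 else 0)"
proof (cases "x = y")
  case True
  then show ?thesis
    using is_GT_basis_orthonormal[OF GT_basis_summand[OF assms(1)] assms(2), of l'] assms(4) by simp
next
  case False
  have "\<forall>(a, \<sigma>)\<in>CG_series m. \<forall>(a', \<sigma>')\<in>CG_series m. (a, \<sigma>) \<noteq> (a', \<sigma>') \<longrightarrow>
      (\<forall>l\<in>GT_labels a. \<forall>l'\<in>GT_labels a'. cinner (E (a, \<sigma>) l) (E (a', \<sigma>') l') = 0)"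
    using coupled[unfolded is_coupled_basis_def, THEN conjunct2] by (rule conjunct1)
  then have "\<forall>x\<in>CG_series m. \<forall>y\<in>CG_series m. x \<noteq> y \<longrightarrow>
      (\<forall>l\<in>GT_labels (fst x). \<forall>l'\<in>GT_labels (fst y). cinner (E x l) (E y l') = 0)"
    by (simp only: case_prod_unfold prod.collapse)
  then show ?thesis using False assms by simp
qed

definition labels :: "((irrep \<times> nat) \<times> gt_label) set" where
  "labels = (SIGMA x:CG_series m. GT_labels (fst x))"

lemma orthonormal:
  "s \<in> labels \<Longrightarrow> s' \<in> labels \<Longrightarrow>
    cinner (case_prod E s) (case_prod E s') = (if s = s' then 1 else 0)"
  unfolding labels_def by (cases s; cases s') (simp only: mem_Sigma_iff prod.case E_orthonormal prod.inject)

lemma finite_labels: "finite labels"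
  by (rule finite_orthonormal[of _ "case_prod E"]) (rule orthonormal)

lemma span_labels: "cspan (case_prod E ` labels) = UNIV"
proof -
  have "case_prod f ` (SIGMA x:S. B x) = (\<Union>x\<in>S. f x ` B x)"
    for f :: "irrep \<times> nat \<Rightarrow> gt_label \<Rightarrow> complex^'n^'n" and S B by auto
  note image_Sigma = this
  have "case_prod E ` labels = (\<Union>(a, \<sigma>)\<in>CG_series m. E (a, \<sigma>) ` GT_labels a)"
    unfolding labels_def image_Sigma by (simp only: case_prod_unfold prod.collapse)
  moreover have "cspan (\<Union>(a, \<sigma>)\<in>CG_series m. E (a, \<sigma>) ` GT_labels a) = UNIV"
    using coupled[unfolded is_coupled_basis_def, THEN conjunct2, THEN conjunct2] by (rule conjunct1)
  ultimately show ?thesis by (simp only:)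
qed

lemma finite_CG_series: "finite (CG_series m)"
proof -
  have "CG_series m \<subseteq> fst ` labels"
  proof
    fix x assume x: "x \<in> CG_series m"
    obtain p' q' where "fst x = (p', q')" by fastforce
    \<comment> \<open>The highest weight label, present in every irrep, shows that each summand
      contributes to \<open>labels\<close>.\<close>
    then have "gt_lab (fst x) 0 (int q') 0 \<in> GT_labels (fst x)"
      by (intro GT_labelsI) auto
    then show "x \<in> fst ` labels" using x unfolding labels_def by force
  qed
  then show ?thesis using finite_labels finite_surj by blast
qed

lemma expansion: "A = (\<Sum>x\<in>CG_series m. \<Sum>l\<in>GT_labels (fst x). cinner (E x l) A *\<^sub>C E x l)"
proof -
  have "A = (\<Sum>s\<in>labels. cinner (case_prod E s) A *\<^sub>C case_prod E s)"
    by (rule orthonormal_expansion[OF finite_labels orthonormal]) (simp_all add: span_labels)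
  also have "\<dots> = (\<Sum>x\<in>CG_series m. \<Sum>l\<in>GT_labels (fst x). cinner (E x l) A *\<^sub>C E x l)"
    unfolding labels_def using finite_CG_series finite_GT_labels
    by (subst sum.Sigma) (auto intro!: sum.cong)
  finally show ?thesis .
qed

lemma eq_0_if_orthogonal:
  assumes "\<And>x l. x \<in> CG_series m \<Longrightarrow> l \<in> GT_labels (fst x) \<Longrightarrow> cinner (E x l) A = 0"
  shows "A = 0"
proof -
  have "(\<Sum>x\<in>CG_series m. \<Sum>l\<in>GT_labels (fst x). cinner (E x l) A *\<^sub>C E x l) = 0"
    by (intro sum.neutral ballI) (simp add: assms)
  then show ?thesis by (rule trans[OF expansion])
qed

text \<open>By adjointness: a basis vector that \<open>n - rm + 1\<close> lowerings take to the given one would lie above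
  the top of its multiplet.\<close>

lemma raise_eq_0:
  assumes K: "\<And>A. U_minus (conj_act \<rho>) A = commutator K A"
    and x: "x \<in> CG_series m" "gt_pattern (fst x) rm rp" "rm \<le> n" "n \<le> rp"
  shows "(commutator (dagger K) ^^ nat (n - rm + 1)) (E x (gt_lab (fst x) rm rp n)) = 0"
proof (rule eq_0_if_orthogonal)
  fix y l assume y: "y \<in> CG_series m" "l \<in> GT_labels (fst y)"
  define k where "k = nat (n - rm + 1)"
  have k: "int k = n - rm + 1" using x by (simp add: k_def)
  obtain rm' rp' n' where l: "l = gt_lab (fst y) rm' rp' n'" "gt_pattern (fst y) rm' rp'" "rm' \<le> n'" "n' \<le> rp'"
    using y(2) GT_labels_iff by metis
  note chain = is_GT_basis_U_minus[OF GT_basis_summand[OF y(1)] l(2), unfolded K]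
  have "cinner ((commutator K ^^ k) (E y l)) (E x (gt_lab (fst x) rm rp n)) = 0"
  proof (cases "n' + int k \<le> rp'")
    case True
    then obtain c where "(commutator K ^^ k) (E y l) = c *\<^sub>R E y (gt_lab (fst y) rm' rp' (n' + int k))"
      using chain_lower[of rm' rp' K "\<lambda>n. E y (gt_lab (fst y) rm' rp' n)" n' k, OF chain] l by auto
    moreover have "gt_lab (fst y) rm' rp' (n' + int k) \<in> GT_labels (fst y)"
      by (rule GT_labelsI) (use l True k x in auto)
    moreover have "gt_lab (fst x) rm rp n \<in> GT_labels (fst x)"
      by (rule GT_labelsI) (use x in auto)
    \<comment> \<open>Equality of the labels would force rm' = rm and n' = n - k = rm - 1, one place
      above the top.\<close>
    moreover have "\<not> (x = y \<and> gt_lab (fst y) rm' rp' (n' + int k) = gt_lab (fst x) rm rp n)"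
      using l(3) k by (auto simp: gt_lab_inject)
    ultimately show ?thesis using E_orthonormal y x by (simp add: cinner_scaleR_left) metis
  next
    case False
    then have "(commutator K ^^ k) (E y l) = 0"
      using chain_lower_eq_0[of rm' rp' K "\<lambda>n. E y (gt_lab (fst y) rm' rp' n)" n' k, OF chain] l by auto
    then show ?thesis by simp
  qed
  then show "cinner (E y l) ((commutator (dagger K) ^^ nat (n - rm + 1)) (E x (gt_lab (fst x) rm rp n))) = 0"
    unfolding k_def[symmetric] cinner_commutator_power by simp
qed

text \<open>The basis vector is a nonzero multiple of the (n - rm)-fold lowering of the top of its
  multiplet. Moved onto \<open>A ** B\<close>, these lowerings become raisings, which give 0 as soon
  as i + j <= n - rm + 1.\<close>

lemma spin_bound:
  assumes K: "\<And>A. U_minus (conj_act \<rho>) A = commutator K A"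
    and x: "x \<in> CG_series m" "gt_pattern (fst x) rm rp" "rm \<le> n" "n \<le> rp"
    and AB: "(commutator (dagger K) ^^ nat i) A = 0" "(commutator (dagger K) ^^ nat j) B = 0" "0 \<le> i" "0 \<le> j"
    and ne: "cinner (E x (gt_lab (fst x) rm rp n)) (A ** B) \<noteq> 0"
  shows "n - rm + 1 < i + j"
proof (rule ccontr)
  assume "\<not> n - rm + 1 < i + j"
  then have ij: "nat i + nat j \<le> Suc (nat (n - rm))" using AB x by linarith
  note chain = is_GT_basis_U_minus[OF GT_basis_summand[OF x(1)] x(2), unfolded K]
  obtain c where c: "c \<noteq> 0" "(commutator K ^^ nat (n - rm)) (E x (gt_lab (fst x) rm rp rm)) =
      c *\<^sub>R E x (gt_lab (fst x) rm rp n)"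
    using chain_lower[of rm rp K "\<lambda>n. E x (gt_lab (fst x) rm rp n)" rm "nat (n - rm)", OF chain] x by auto
  have "complex_of_real c * cinner (E x (gt_lab (fst x) rm rp n)) (A ** B) = 0"
    using cinner_lowered_mult_eq_0[OF AB(1,2) ij, of "E x (gt_lab (fst x) rm rp rm)"]
    by (simp add: c(2) cinner_scaleR_left)
  then show False using c(1) ne by simp
qed

lemma selection_rules:
  assumes x: "x \<in> CG_series m" "(\<nu>, J) \<in> GT_labels (fst x)"
    and x1: "x1 \<in> CG_series m" "(\<nu>1, J1) \<in> GT_labels (fst x1)"
    and x2: "x2 \<in> CG_series m" "(\<nu>2, J2) \<in> GT_labels (fst x2)"
    and ne: "cinner (E x (\<nu>, J)) (E x1 (\<nu>1, J1) ** E x2 (\<nu>2, J2)) \<noteq> 0"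
  shows "gt_t \<nu> = gt_t \<nu>1 + gt_t \<nu>2" "gt_u \<nu> = gt_u \<nu>1 + gt_u \<nu>2" "triangle_delta J1 J2 J = 1"
proof -
  note weights = is_GT_basis_weights[OF GT_basis_summand[OF x(1)] x(2)]
    is_GT_basis_weights[OF GT_basis_summand[OF x1(1)] x1(2)]
    is_GT_basis_weights[OF GT_basis_summand[OF x2(1)] x2(2)]
  obtain T where T: "\<And>A. T_three (conj_act \<rho>) A = commutator T A" "\<And>A. commutator (dagger T) A = commutator T A"
    using T_three_conj_act by blast
  show "gt_t \<nu> = gt_t \<nu>1 + gt_t \<nu>2"
    by (rule hermitian_weights_add[OF T(2) _ _ _ ne]) (use weights in \<open>simp_all add: T(1)\<close>)
  obtain U where U: "\<And>A. U_three (conj_act \<rho>) A = commutator U A" "\<And>A. commutator (dagger U) A = commutator U A"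
    using U_three_conj_act by blast
  show u: "gt_u \<nu> = gt_u \<nu>1 + gt_u \<nu>2"
    by (rule hermitian_weights_add[OF U(2) _ _ _ ne]) (use weights in \<open>simp_all add: U(1)\<close>)
  obtain K where K: "\<And>A. U_minus (conj_act \<rho>) A = commutator K A" using U_minus_conj_act by blast
  obtain r s n where l: "(\<nu>, J) = gt_lab (fst x) r s n" and y: "gt_pattern (fst x) r s" "r \<le> n" "n \<le> s"
    using x(2) GT_labels_iff by metis
  obtain r1 s1 n1 where l1: "(\<nu>1, J1) = gt_lab (fst x1) r1 s1 n1"
    and y1: "gt_pattern (fst x1) r1 s1" "r1 \<le> n1" "n1 \<le> s1"
    using x1(2) GT_labels_iff by metis
  obtain r2 s2 n2 where l2: "(\<nu>2, J2) = gt_lab (fst x2) r2 s2 n2"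
    and y2: "gt_pattern (fst x2) r2 s2" "r2 \<le> n2" "n2 \<le> s2"
    using x2(2) GT_labels_iff by metis
  let ?C = "E x (gt_lab (fst x) r s n)" and ?A = "E x1 (gt_lab (fst x1) r1 s1 n1)"
    and ?B = "E x2 (gt_lab (fst x2) r2 s2 n2)"
  have C: "cinner ?C (?A ** ?B) \<noteq> 0" using ne unfolding l l1 l2 .
  \<comment> \<open>The trilinear form \<open>tr(C\<^sup>\<dagger>AB)\<close> is cyclic, so each of the three vectors can play the role of
    the product; this gives the three triangle inequalities.\<close>
  then have A: "cinner ?A (?C ** dagger ?B) \<noteq> 0"
    unfolding cinner_mult_right[of ?C] by (subst cinner_commute) simp
  from C have B: "cinner ?B (dagger ?A ** ?C) \<noteq> 0"
    unfolding cinner_mult_left[of ?C] by (subst cinner_commute) simp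
  note raise = raise_eq_0[OF K x(1) y] raise_eq_0[OF K x1(1) y1] raise_eq_0[OF K x2(1) y2]
  \<comment> \<open>The exponent is J1 + u1 + 1 instead of J1 - u1 + 1, because taking the adjoint
    reverses the weight.\<close>
  have A': "(commutator (dagger K) ^^ nat (s1 - n1 + 1)) (dagger ?A) = 0"
    using chain_lower_eq_0[of r1 s1 K "\<lambda>n. E x1 (gt_lab (fst x1) r1 s1 n)" n1 "nat (s1 - n1 + 1)",
        OF is_GT_basis_U_minus[OF GT_basis_summand[OF x1(1)] y1(1), unfolded K]] y1
    by (intro dagger_commutator_power_eq_0) simp
  have B': "(commutator (dagger K) ^^ nat (s2 - n2 + 1)) (dagger ?B) = 0"
    using chain_lower_eq_0[of r2 s2 K "\<lambda>n. E x2 (gt_lab (fst x2) r2 s2 n)" n2 "nat (s2 - n2 + 1)",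
        OF is_GT_basis_U_minus[OF GT_basis_summand[OF x2(1)] y2(1), unfolded K]] y2
    by (intro dagger_commutator_power_eq_0) simp
  \<comment> \<open>As n - r = J - u and s - n = J + u, and likewise for the indexed labels, this
    says J - u <= (J1 - u1) + (J2 - u2). With u = u1 + u2 the weights drop out of this bound and of
    the next two, leaving exactly the triangle inequalities.\<close>
  have 1: "n - r + 1 < (n1 - r1 + 1) + (n2 - r2 + 1)"
    by (rule spin_bound[OF K x(1) y raise(2,3) _ _ C]) (use y1 y2 in simp_all)
  have 2: "n1 - r1 + 1 < (n - r + 1) + (s2 - n2 + 1)"
    by (rule spin_bound[OF K x1(1) y1 raise(1) B' _ _ A]) (use y y2 in simp_all)
  have 3: "n2 - r2 + 1 < (s1 - n1 + 1) + (n - r + 1)"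
    by (rule spin_bound[OF K x2(1) y2 A' raise(1) _ _ B]) (use y y1 in simp_all)
  have par: "gt_u \<nu>' = real_of_int (s' + r' - 2 * n') / 2" "J' = real_of_int (s' - r') / 2"
    if "(\<nu>', J') = gt_lab a' r' s' n'" for \<nu>' J' a' r' s' n'
    using gt_lab_parameters(2,3)[of a' r' s' n' "fst \<nu>'" "fst (snd \<nu>')" "snd (snd \<nu>')" J'] that by simp_all
  have "real_of_int (s + r - 2 * n) = real_of_int ((s1 + r1 - 2 * n1) + (s2 + r2 - 2 * n2))"
    using u unfolding par(1)[OF l] par(1)[OF l1] par(1)[OF l2]
      add_divide_distrib[symmetric] of_int_add[symmetric] divide_cancel_right by simp
  then have sum: "s + r - 2 * n = (s1 + r1 - 2 * n1) + (s2 + r2 - 2 * n2)" by (simp only: of_int_eq_iff)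
  have J: "J = real_of_int (s - r) / 2" "J1 = real_of_int (s1 - r1) / 2" "J2 = real_of_int (s2 - r2) / 2"
    using par(2) l l1 l2 by blast+
  have "s - r \<le> (s1 - r1) + (s2 - r2)" "s1 - r1 \<le> (s - r) + (s2 - r2)" "s2 - r2 \<le> (s - r) + (s1 - r1)"
    using 1 2 3 sum by linarith+
  then have "real_of_int (s - r) \<le> real_of_int (s1 - r1) + real_of_int (s2 - r2)"
    "real_of_int (s1 - r1) \<le> real_of_int (s - r) + real_of_int (s2 - r2)"
    "real_of_int (s2 - r2) \<le> real_of_int (s - r) + real_of_int (s1 - r1)"
    unfolding of_int_add[symmetric] of_int_le_iff .
  then have "\<bar>J1 - J2\<bar> \<le> J \<and> J \<le> J1 + J2"
    unfolding J abs_le_iff by (simp add: field_simps)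
  \<comment> \<open>The integer is (J + u) + (J1 - u1) + (J2 - u2), in which the weights
    cancel.\<close>
  moreover have "J1 + J2 + J = real_of_int (s - n + n1 - r1 + n2 - r2)"
  proof -
    have "(s - r) + (s1 - r1) + (s2 - r2) = 2 * (s - n + n1 - r1 + n2 - r2)" using sum by presburger
    then have "real_of_int ((s - r) + (s1 - r1) + (s2 - r2)) = real_of_int (2 * (s - n + n1 - r1 + n2 - r2))"
      by (simp only:)
    then show ?thesis unfolding J by (simp add: field_simps)
  qed
  ultimately show "triangle_delta J1 J2 J = 1" unfolding triangle_delta_def by simp
qed

end

theorem theorem5p29:
  fixes p :: irrep
    and \<rho> :: "complex^3^3 \<Rightarrow> complex^'n^'n"
    and e :: "gt_label \<Rightarrow> complex^'n"
    and m :: "irrep \<Rightarrow> nat"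
    and E :: "irrep \<times> nat \<Rightarrow> gt_label \<Rightarrow> complex^'n^'n"
    and V :: "irrep \<Rightarrow> 'h::complex_inner_space set"
    and \<pi> :: "irrep \<Rightarrow> 'h action"
    and \<epsilon> :: "irrep \<Rightarrow> gt_label \<Rightarrow> 'h"
    and \<mu> :: "flag measure"
    and W :: "complex^'n^'n \<Rightarrow> flag \<Rightarrow> complex"
    and c :: "irrep \<Rightarrow> nat \<Rightarrow> nat \<Rightarrow> complex"
  assumes "p \<noteq> (0, 0)"
    and "is_irrep p UNIV (\<lambda>g v. \<rho> g *v v)"
    and "is_GT_basis p UNIV (\<lambda>g v. \<rho> g *v v) e"
    and "is_coupled_basis p \<rho> e m E"
    and "\<And>a. 1 \<le> m a \<Longrightarrow> is_irrep a (V a) (\<pi> a) \<and> is_GT_basis a (V a) (\<pi> a) (\<epsilon> a)"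
    and "is_invariant_measure \<mu>"
    and "is_symbol_correspondence p \<rho> \<mu> W"
    and "is_characteristic p m E \<pi> \<epsilon> W c"
    and "(a\<^sub>1, \<sigma>\<^sub>1) \<in> CG_series m" and "(\<nu>\<^sub>1, J\<^sub>1) \<in> GT_labels a\<^sub>1"
    and "(a\<^sub>2, \<sigma>\<^sub>2) \<in> CG_series m" and "(\<nu>\<^sub>2, J\<^sub>2) \<in> GT_labels a\<^sub>2"
  shows "twisted_product W (ZC \<pi> \<epsilon> c (a\<^sub>1, \<sigma>\<^sub>1) (\<nu>\<^sub>1, J\<^sub>1)) (ZC \<pi> \<epsilon> c (a\<^sub>2, \<sigma>\<^sub>2) (\<nu>\<^sub>2, J\<^sub>2)) =
      (\<lambda>z. complex_of_real (sqrt (irrep_dim p)) *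
        (\<Sum>(a, \<sigma>)\<in>CG_series m. \<Sum>(\<nu>, J)\<in>GT_labels a.
           gt_sign (real (irrep_size p) + 2 * (gt_t \<nu> + gt_u \<nu>)) *
           wigner_symbol p e E (a\<^sub>1, \<sigma>\<^sub>1) (\<nu>\<^sub>1, J\<^sub>1) (a\<^sub>2, \<sigma>\<^sub>2) (\<nu>\<^sub>2, J\<^sub>2) (a, \<sigma>) (gt_check a \<nu>, J) *
           ZC \<pi> \<epsilon> c (a, \<sigma>) (\<nu>, J) z)) \<and>
    (\<forall>(a, \<sigma>)\<in>CG_series m. \<forall>(\<nu>, J)\<in>GT_labels a.
      wigner_symbol p e E (a\<^sub>1, \<sigma>\<^sub>1) (\<nu>\<^sub>1, J\<^sub>1) (a\<^sub>2, \<sigma>\<^sub>2) (\<nu>\<^sub>2, J\<^sub>2) (a, \<sigma>) (gt_check a \<nu>, J) \<noteq> 0 \<longrightarrow>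
      gt_t \<nu> = gt_t \<nu>\<^sub>1 + gt_t \<nu>\<^sub>2 \<and> gt_u \<nu> = gt_u \<nu>\<^sub>1 + gt_u \<nu>\<^sub>2 \<and> triangle_delta J\<^sub>1 J\<^sub>2 J = 1)"
proof -
  interpret coupled_operators p \<rho> e m E
    using assms(2,4) by unfold_locales (simp_all add: is_irrep_def)
  define d where "d = sqrt (irrep_dim p)"
  have basis: "cinner (e l) (e l') = (if l = l' then 1 else 0)"
    if "l \<in> GT_labels p" "l' \<in> GT_labels p" for l l'
    using is_GT_basis_orthonormal[OF assms(3)] that .
  have span: "cspan (e ` GT_labels p) = UNIV"
    using assms(3) by (cases p) (simp del: GT_labels.simps)
  have "\<forall>(a, \<sigma>)\<in>CG_series m. \<forall>l\<in>GT_labels a. \<forall>l1\<in>GT_labels p. \<forall>l2\<in>GT_labels (irrep_dual p).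
      CG_coeff p e E (a, \<sigma>) l1 l2 l \<in> \<real>"
    using coupled[unfolded is_coupled_basis_def, THEN conjunct2, THEN conjunct2, THEN conjunct2]
    by (rule conjunct1)
  then have real: "CG_coeff p e E x l1 l2 l \<in> \<real>"
    if "x \<in> CG_series m" "l \<in> GT_labels (fst x)" "l1 \<in> GT_labels p" "l2 \<in> GT_labels (irrep_dual p)" for x l1 l2 l
    using that by (simp only: case_prod_unfold prod.collapse)
  let ?x1 = "(a\<^sub>1, \<sigma>\<^sub>1)" and ?x2 = "(a\<^sub>2, \<sigma>\<^sub>2)" and ?l1 = "(\<nu>\<^sub>1, J\<^sub>1)" and ?l2 = "(\<nu>\<^sub>2, J\<^sub>2)"
  have symbol: "gt_sign (real (irrep_size p) + 2 * (gt_t \<nu> + gt_u \<nu>)) *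
      wigner_symbol p e E ?x1 ?l1 ?x2 ?l2 (a, \<sigma>) (gt_check a \<nu>, J) =
      cinner (E (a, \<sigma>) (\<nu>, J)) (E ?x1 ?l1 ** E ?x2 ?l2)" for a \<sigma> \<nu> J
    by (rule wigner_symbol_eq_cinner[OF basis span])
      (use real[OF assms(9), of ?l1] real[OF assms(11), of ?l2] assms(10,12) in simp_all)
  have W: "inj W" "\<And>A B z. W (A + B) z = W A z + W B z" "\<And>c A z. W (c *\<^sub>C A) z = c * W A z"
    using assms(7) unfolding is_symbol_correspondence_def by blast+
  have W_sum: "W (sum f S) z = (\<Sum>s\<in>S. W (f s) z)" for S z and f :: "'s \<Rightarrow> complex^'n^'n"
  proof -
    have "W 0 z = 0" using W(3)[of 0 0 z] by simp
    then show ?thesis by (induction S rule: infinite_finite_induct) (simp_all add: W(2))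
  qed
  have "\<forall>(a, \<sigma>)\<in>CG_series m. \<forall>l\<in>GT_labels a. W (d *\<^sub>R E (a, \<sigma>) l) = ZC \<pi> \<epsilon> c (a, \<sigma>) l"
    using assms(8) unfolding is_characteristic_def d_def .
  then have ZC: "ZC \<pi> \<epsilon> c x l = W (d *\<^sub>R E x l)" if "x \<in> CG_series m" "l \<in> GT_labels (fst x)" for x l
    using that by (simp only: case_prod_unfold prod.collapse)
  show ?thesis
  proof (intro conjI ext)
    fix z
    have "twisted_product W (ZC \<pi> \<epsilon> c ?x1 ?l1) (ZC \<pi> \<epsilon> c ?x2 ?l2) z =
        W ((d *\<^sub>R E ?x1 ?l1) ** (d *\<^sub>R E ?x2 ?l2)) z"
      using ZC[OF assms(9), of ?l1] ZC[OF assms(11), of ?l2] assms(10,12)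
      by (simp only: fst_conv twisted_product_symbols[OF W(1)])
    also have "\<dots> = W (complex_of_real (d * d) *\<^sub>C (E ?x1 ?l1 ** E ?x2 ?l2)) z"
      by (simp only: scaleR_conv_cscale matrix_cscale_left matrix_cscale_right cscale_cscale of_real_mult)
    \<comment> \<open>One factor \<open>d\<close> is the prefactor of the formula; the other is
      absorbed into the \<open>ZC\<close> functions of the expanded product.\<close>
    also have "\<dots> = of_real d * (of_real d * W (E ?x1 ?l1 ** E ?x2 ?l2) z)"
      by (simp only: W(3) of_real_mult mult.assoc)
    also have "W (E ?x1 ?l1 ** E ?x2 ?l2) z =
        (\<Sum>x\<in>CG_series m. \<Sum>l\<in>GT_labels (fst x). cinner (E x l) (E ?x1 ?l1 ** E ?x2 ?l2) * W (E x l) z)"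
      by (subst expansion[of "E ?x1 ?l1 ** E ?x2 ?l2"]) (simp only: W_sum W(3))
    also have "of_real d * \<dots> =
        (\<Sum>x\<in>CG_series m. \<Sum>l\<in>GT_labels (fst x). cinner (E x l) (E ?x1 ?l1 ** E ?x2 ?l2) * ZC \<pi> \<epsilon> c x l z)"
      unfolding sum_distrib_left
      by (intro sum.cong refl) (simp only: ZC scaleR_conv_cscale W(3) mult.left_commute)
    also have "\<dots> = (\<Sum>(a, \<sigma>)\<in>CG_series m. \<Sum>(\<nu>, J)\<in>GT_labels a.
           gt_sign (real (irrep_size p) + 2 * (gt_t \<nu> + gt_u \<nu>)) *
           wigner_symbol p e E ?x1 ?l1 ?x2 ?l2 (a, \<sigma>) (gt_check a \<nu>, J) * ZC \<pi> \<epsilon> c (a, \<sigma>) (\<nu>, J) z)"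
      unfolding symbol by (simp only: case_prod_unfold prod.collapse)
    finally show "twisted_product W (ZC \<pi> \<epsilon> c ?x1 ?l1) (ZC \<pi> \<epsilon> c ?x2 ?l2) z =
        complex_of_real (sqrt (irrep_dim p)) * (\<Sum>(a, \<sigma>)\<in>CG_series m. \<Sum>(\<nu>, J)\<in>GT_labels a.
           gt_sign (real (irrep_size p) + 2 * (gt_t \<nu> + gt_u \<nu>)) *
           wigner_symbol p e E ?x1 ?l1 ?x2 ?l2 (a, \<sigma>) (gt_check a \<nu>, J) * ZC \<pi> \<epsilon> c (a, \<sigma>) (\<nu>, J) z)"
      unfolding d_def .
  next
    have "gt_t \<nu> = gt_t \<nu>\<^sub>1 + gt_t \<nu>\<^sub>2 \<and> gt_u \<nu> = gt_u \<nu>\<^sub>1 + gt_u \<nu>\<^sub>2 \<and> triangle_delta J\<^sub>1 J\<^sub>2 J = 1"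
      if x: "(a, \<sigma>) \<in> CG_series m" "(\<nu>, J) \<in> GT_labels a"
        and ne: "wigner_symbol p e E ?x1 ?l1 ?x2 ?l2 (a, \<sigma>) (gt_check a \<nu>, J) \<noteq> 0" for a \<sigma> \<nu> J
    proof -
      \<comment> \<open>The sign is invertible, so a nonzero symbol means a nonzero coefficient of
        the operator product.\<close>
      have "gt_sign y \<noteq> 0" for y by (simp add: gt_sign_def)
      then have "cinner (E (a, \<sigma>) (\<nu>, J)) (E ?x1 ?l1 ** E ?x2 ?l2) \<noteq> 0"
        unfolding symbol[symmetric] using ne mult_eq_0_iff by blast
      from selection_rules[OF x(1) _ assms(9) _ assms(11) _ this] show ?thesis
        using x(2) assms(10,12) by (simp del: GT_labels.simps)
    qed
    then show "\<forall>(a, \<sigma>)\<in>CG_series m. \<forall>(\<nu>, J)\<in>GT_labels a.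
      wigner_symbol p e E ?x1 ?l1 ?x2 ?l2 (a, \<sigma>) (gt_check a \<nu>, J) \<noteq> 0 \<longrightarrow>
      gt_t \<nu> = gt_t \<nu>\<^sub>1 + gt_t \<nu>\<^sub>2 \<and> gt_u \<nu> = gt_u \<nu>\<^sub>1 + gt_u \<nu>\<^sub>2 \<and> triangle_delta J\<^sub>1 J\<^sub>2 J = 1"
      by blast
  qed
qed

end
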